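(* Let $D,E$ be effective divisors of degree $\delta$ on $C$ such that $D_0,D$ are disjoint from $E_0,E$. Let $0\neq s\in V_2$ be a section such that $(s)_2=D+D'$ for some effective divisor $D'$ of degree $\delta$, and suppose that $D'$ is disjoint from $E$ and $E_0$. Then $x=[\mathcal L^\vee(D)]$ and $x'=[\mathcal L^\vee(D')]\in J(K)$ satisfy $x+x'=0$, and $$[D,E]^{\overset{1}{\otimes}-1}=\lambda\cdot[D',E],\qquad\lambda=\left(\frac{s}{d_0^2}\right)(E_0)\cdot\left(\frac{d_0^2}{s}\right)(E)\in K^\times.$$
   Context: $K$ is a field, $C$ is a nonsingular, complete, geometrically integral curve over $K$ of genus $g$ with $C(K)\neq\emptyset$, and $J$ is its Jacobian, so $J(K)=\operatorname{Pic}^0(C)$. For a nonzero rational function $f$, $(f)$ is its divisor; if $F=\sum_P n_P P$ is a divisor with support disjoint from that of $(f)$, then $f(F)=\prod_P N_{\kappa(P)/K}(f(P))^{n_P}\in K^\times$. For sections $s_1,s_2$ of the same line bundle and an effective divisor $F$ disjoint from their divisors, $(s_1/s_2)(F)$ is the value at $F$ of the rational function $s_1/s_2$. Norms: for a divisor $F=\sum_P n_PP$ and a line bundle $\mathcal M$ on $C$, $\mathcal N_F(\mathcal M)$ is the one-dimensional $K$-vector space $\bigotimes_P \mathrm{Norm}_{\kappa(P)/K}(\mathcal M|_P)^{\otimes n_P}$. It is additive in $F$ and functorial and multiplicative in $\mathcal M$. A meromorphic section $s$ of $\mathcal M$ which is regular and non-vanishing around $\operatorname{Supp}F$ has a nonzero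 norm $\mathcal N_F(s\in\mathcal M)$, and $\mathcal N_F(hs)=h(F)\,\mathcal N_F(s)$ for a function $h$ regular and non-vanishing around $\operatorname{Supp}F$. Poincaré torsor: $\mathcal P$ is the Poincaré (Mumford) bundle on $J\times J$ (identifying $J$ with its dual). For $x=[D]$, $y=[E]\in J(K)$ with $D,E\in\operatorname{Div}^0(C)$, its fibre at $(x,y)$ is $\mathcal P_{x,y}=\mathcal N_D(\mathcal O_C(E))$, where the spaces obtained from different choices of $D,E$ are identified as follows: (i) $\mathcal N_D(\mathcal O_C(E+(f)))\simeq\mathcal N_D(\mathcal O_C(E))$ is induced by the isomorphism $\mathcal O_C(E+(f))\to\mathcal O_C(E)$, $h\mapsto fh$; (ii) $\mathcal N_{D+(f)}(\mathcal O_C(E))\simeq\mathcal N_D(\mathcal O_C(E))$ identifies $\mathcal N_{D+(f)}(s)$ with $f((s)_E)\cdot\mathcal N_D(s)$, for any meromorphic section $s$ of $\mathcal O_C(E)$ whose divisor $(s)_E$ as a section of $\mathcal O_C(E)$ is disjoint from $D$ and from $(f)$. $\mathcal P^\times$ is $\mathcal P$ with its zero section removed; its fibres are $K^\times$-torsors, the action being written $\lambda\cdot\pi$. For $D,E\in\operatorname{Div}^0(C)$ with disjoint supports, $(D,E)$ denotes the point $\mathcal N_D(1\in\mathcal O_C(E))\in\mathcal P^\times_{[D],[E]}$. The left partial group law $\overset{1}{\otimes}:\mathcal P^\times_{x,y}\times\mathcal P^\times_{x',y}\to\mathcal P^\times_{x+x',y}$ is induced by the canonical isomorphism $\mathcal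 N_D(\mathcal O_C(E))\otimes\mathcal N_{D'}(\mathcal O_C(E))\simeq\mathcal N_{D+D'}(\mathcal O_C(E))$; the inverse $\pi^{\overset{1}{\otimes}-1}\in\mathcal P^\times_{-x,y}$ of $\pi\in\mathcal P^\times_{x,y}$ is the point such that $\pi\overset{1}{\otimes}\pi^{\overset{1}{\otimes}-1}$ corresponds to $1\in K^\times$ under the canonical trivialisation $\mathcal P^\times_{0,y}=\mathcal N_0(\mathcal O_C(E))\setminus\{0\}=K^\times$. Fix a line bundle $\mathcal L$ on $C$ of degree $\delta\ge 2g+1$, with dual $\mathcal L^\vee$, and put $V_n=H^0(C,\mathcal L^{\otimes n})$. For $0\ne s\in V_n$, $(s)_n$ is its divisor as a section of $\mathcal L^{\otimes n}$. Fix nonzero $d_0,e_0\in V_1$ whose divisors $D_0=(d_0)_1$ and $E_0=(e_0)_1$ are disjoint. An effective divisor $D$ of degree $\delta$ represents the point $[\mathcal L^\vee(D)]=[D-D_0]=[D-E_0]$ of $J(K)$. For effective divisors $D,E$ of degree $\delta$ such that $D$ and $D_0$ are disjoint from $E$ and $E_0$, put $[D,E]:=(D-D_0,\,E-E_0)\in\mathcal P^\times$. "Disjoint" means having disjoint supports. *)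

theory Defs
  imports
    "HOL-Algebra.Algebraic_Closure_Type"
    "HOL-Library.Function_Algebras"
    "Jordan_Normal_Form.Determinant"
begin

section \<open>Curves\<close>

text \<open>
  A nonsingular complete curve over a field \<open>K\<close> is given by its function field \<open>F\<close>, a finitely
  generated extension of transcendence degree one, with structure map \<open>\<iota> : K \<rightarrow> F\<close>. The local rings
  at its closed points are exactly the discrete valuation rings of \<open>F\<close> containing \<open>K\<close>, and a
  closed point is identified with its local ring, a subset of \<open>F\<close> (Hartshorne, Section I.6).
\<close>

subsection \<open>Quotients of vector spaces\<close>

text \<open>\<open>bs\<close> consists of representatives in \<open>V\<close> of a basis of \<open>V / W\<close>.\<close>

definition quotient_coords ::
  "('k::field \<Rightarrow> 'v::ab_group_add \<Rightarrow> 'v) \<Rightarrow> 'v set \<Rightarrow> 'v list \<Rightarrow> 'v \<Rightarrow> 'k list \<Rightarrow> bool" where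
  "quotient_coords scale W bs v cs \<longleftrightarrow>
     length cs = length bs \<and> v - (\<Sum>i<length bs. scale (cs ! i) (bs ! i)) \<in> W"

definition quotient_basis ::
  "('k::field \<Rightarrow> 'v::ab_group_add \<Rightarrow> 'v) \<Rightarrow> 'v set \<Rightarrow> 'v set \<Rightarrow> 'v list \<Rightarrow> bool" where
  "quotient_basis scale V W bs \<longleftrightarrow>
     set bs \<subseteq> V \<and> (\<forall>v\<in>V. \<exists>!cs. quotient_coords scale W bs v cs)"

definition quotient_dim ::
  "('k::field \<Rightarrow> 'v::ab_group_add \<Rightarrow> 'v) \<Rightarrow> 'v set \<Rightarrow> 'v set \<Rightarrow> nat" where
  "quotient_dim scale V W = (THE n. \<exists>bs. quotient_basis scale V W bs \<and> length bs = n)"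

subsection \<open>Function fields\<close>

definition rational_subfield :: "('k::field \<Rightarrow> 'f::field) \<Rightarrow> 'f \<Rightarrow> 'f set" where
  "rational_subfield \<iota> x =
     {poly (map_poly \<iota> p) x / poly (map_poly \<iota> q) x | p q. poly (map_poly \<iota> q) x \<noteq> 0}"

definition function_field :: "('k::field \<Rightarrow> 'f::field) \<Rightarrow> bool" where
  "function_field \<iota> \<longleftrightarrow> field_hom \<iota> \<and>
     (\<exists>x. (\<forall>p. p \<noteq> 0 \<longrightarrow> poly (map_poly \<iota> p) x \<noteq> 0) \<and>
          (\<exists>bs. \<forall>f. \<exists>cs. length cs = length bs \<and> set cs \<subseteq> rational_subfield \<iota> x \<and>
                         f = (\<Sum>i<length bs. cs ! i * bs ! i)))"

text \<open>
  Given \<open>i : K \<rightarrow> A\<close> and \<open>j : K \<rightarrow> B\<close>, a list of pairs stands for a sum of pure tensors in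
  the tensor product of \<open>A\<close> and \<open>B\<close> over \<open>K\<close>, and \<open>tensor_eq i j\<close> is equality there.
\<close>

inductive tensor_eq ::
  "('k::field \<Rightarrow> 'a::comm_ring_1) \<Rightarrow> ('k \<Rightarrow> 'b::comm_ring_1) \<Rightarrow>
     ('a \<times> 'b) list \<Rightarrow> ('a \<times> 'b) list \<Rightarrow> bool"
  for i j where
  refl: "tensor_eq i j xs xs"
| sym: "tensor_eq i j xs ys \<Longrightarrow> tensor_eq i j ys xs"
| trans: "tensor_eq i j xs ys \<Longrightarrow> tensor_eq i j ys zs \<Longrightarrow> tensor_eq i j xs zs"
| append: "tensor_eq i j xs xs' \<Longrightarrow> tensor_eq i j ys ys' \<Longrightarrow> tensor_eq i j (xs @ ys) (xs' @ ys')"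
| commute: "tensor_eq i j (xs @ ys) (ys @ xs)"
| zero: "tensor_eq i j [(0, b)] []"
| add_left: "tensor_eq i j [(a + a', b)] [(a, b), (a', b)]"
| add_right: "tensor_eq i j [(a, b + b')] [(a, b), (a, b')]"
| balanced: "tensor_eq i j [(i k * a, b)] [(a, j k * b)]"

definition tensor_mult ::
  "('a::comm_ring_1 \<times> 'b::comm_ring_1) list \<Rightarrow> ('a \<times> 'b) list \<Rightarrow> ('a \<times> 'b) list" where
  "tensor_mult xs ys = [(a * a', b * b'). (a, b) \<leftarrow> xs, (a', b') \<leftarrow> ys]"

text \<open>
  The curve is geometrically integral iff the tensor product of its function field with an
  algebraic closure of \<open>K\<close> is an integral domain.
\<close>

definition geometrically_integral :: "('k::field \<Rightarrow> 'f::field) \<Rightarrow> bool" where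
  "geometrically_integral \<iota> \<longleftrightarrow>
     (\<forall>xs ys. tensor_eq \<iota> (to_ac :: 'k \<Rightarrow> 'k alg_closure) (tensor_mult xs ys) [] \<longrightarrow>
              tensor_eq \<iota> to_ac xs [] \<or> tensor_eq \<iota> to_ac ys [])"

definition curve :: "('k::field \<Rightarrow> 'f::field) \<Rightarrow> bool" where
  "curve \<iota> \<longleftrightarrow> function_field \<iota> \<and> geometrically_integral \<iota>"

subsection \<open>Closed points\<close>

type_synonym 'f point = "'f set"

definition unit_at :: "'f::field point \<Rightarrow> 'f \<Rightarrow> bool" where
  "unit_at P u \<longleftrightarrow> u \<noteq> 0 \<and> u \<in> P \<and> inverse u \<in> P"

definition uniformizer_at :: "'f::field point \<Rightarrow> 'f \<Rightarrow> bool" where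
  "uniformizer_at P t \<longleftrightarrow> t \<in> P \<and> t \<noteq> 0 \<and> inverse t \<notin> P \<and>
     (\<forall>f. f \<noteq> 0 \<longrightarrow> (\<exists>n u. unit_at P u \<and> f = t powi n * u))"

definition closed_points :: "('k::field \<Rightarrow> 'f::field) \<Rightarrow> 'f point set" where
  "closed_points \<iota> = {P. range \<iota> \<subseteq> P \<and> (\<forall>f\<in>P. \<forall>g\<in>P. f + g \<in> P \<and> f * g \<in> P \<and> - f \<in> P) \<and>
                         (\<exists>t. uniformizer_at P t)}"

definition max_ideal :: "'f::field point \<Rightarrow> 'f set" where
  "max_ideal P = {f \<in> P. \<not> unit_at P f}"

definition ord_at :: "'f::field point \<Rightarrow> 'f \<Rightarrow> int" where
  "ord_at P f = (THE n. \<exists>t u. uniformizer_at P t \<and> unit_at P u \<and> f = t powi n * u)"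

definition residue_degree :: "('k::field \<Rightarrow> 'f::field) \<Rightarrow> 'f point \<Rightarrow> nat" where
  "residue_degree \<iota> P = quotient_dim (\<lambda>c f. \<iota> c * f) P (max_ideal P)"

text \<open>
  The norm from the residue field at \<open>P\<close> to \<open>K\<close> of the value \<open>f(P)\<close>, as the determinant of
  multiplication by \<open>f(P)\<close>. Residue fields are finite over \<open>K\<close>, so the last case does not arise
  on a curve.
\<close>

definition residue_norm :: "('k::field \<Rightarrow> 'f::field) \<Rightarrow> 'f point \<Rightarrow> 'f \<Rightarrow> 'k" where
  "residue_norm \<iota> P f =
     (let basis = quotient_basis (\<lambda>c f. \<iota> c * f) P (max_ideal P);
          coords = quotient_coords (\<lambda>c f. \<iota> c * f) (max_ideal P)
      in if \<exists>bs. basis bs then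
           let bs = (SOME bs. basis bs)
           in det (mat (length bs) (length bs) (\<lambda>(i, j). (THE cs. coords bs (f * bs ! j) cs) ! i))
         else 1)"

text \<open>
  The genus is the dimension of \<open>H\<^sup>1(C, O\<^sub>C)\<close>, computed from the flasque resolution of \<open>O\<^sub>C\<close> by the
  constant sheaf \<open>F\<close> and the sum of the skyscraper sheaves \<open>F / O\<^sub>P\<close>, that is, as repartitions
  modulo everywhere regular repartitions and constants from \<open>F\<close>.
\<close>

definition repartitions :: "('k::field \<Rightarrow> 'f::field) \<Rightarrow> ('f point \<Rightarrow> 'f) set" where
  "repartitions \<iota> = {r. finite {P \<in> closed_points \<iota>. r P \<notin> P} \<and> (\<forall>P. P \<notin> closed_points \<iota> \<longrightarrow> r P = 0)}"

definition trivial_repartitions :: "('k::field \<Rightarrow> 'f::field) \<Rightarrow> ('f point \<Rightarrow> 'f) set" where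
  "trivial_repartitions \<iota> = {r \<in> repartitions \<iota>. \<exists>f. \<forall>P\<in>closed_points \<iota>. r P - f \<in> P}"

definition genus :: "('k::field \<Rightarrow> 'f::field) \<Rightarrow> nat" where
  "genus \<iota> = quotient_dim (\<lambda>c r P. \<iota> c * r P) (repartitions \<iota>) (trivial_repartitions \<iota>)"

section \<open>Divisors and the Jacobian\<close>

type_synonym 'f divisor = "'f point \<Rightarrow> int"

definition supp :: "'f divisor \<Rightarrow> 'f point set" where
  "supp D = {P. D P \<noteq> 0}"

definition divisors :: "('k::field \<Rightarrow> 'f::field) \<Rightarrow> 'f divisor set" where
  "divisors \<iota> = {D. finite (supp D) \<and> supp D \<subseteq> closed_points \<iota>}"

definition effective_divisors :: "('k::field \<Rightarrow> 'f::field) \<Rightarrow> 'f divisor set" where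
  "effective_divisors \<iota> = {D \<in> divisors \<iota>. \<forall>P. 0 \<le> D P}"

definition div_degree :: "('k::field \<Rightarrow> 'f::field) \<Rightarrow> 'f divisor \<Rightarrow> int" where
  "div_degree \<iota> D = (\<Sum>P\<in>supp D. D P * int (residue_degree \<iota> P))"

definition divisors0 :: "('k::field \<Rightarrow> 'f::field) \<Rightarrow> 'f divisor set" where
  "divisors0 \<iota> = {D \<in> divisors \<iota>. div_degree \<iota> D = 0}"

definition disjoint_divisors :: "'f divisor \<Rightarrow> 'f divisor \<Rightarrow> bool" where
  "disjoint_divisors D E \<longleftrightarrow> supp D \<inter> supp E = {}"

definition principal_divisor :: "('k::field \<Rightarrow> 'f::field) \<Rightarrow> 'f \<Rightarrow> 'f divisor" where
  "principal_divisor \<iota> f = (\<lambda>P. if P \<in> closed_points \<iota> then ord_at P f else 0)"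

text \<open>The value \<open>f(F)\<close>, for \<open>f\<close> a unit at all points of the support of \<open>F\<close>.\<close>

definition value_at :: "('k::field \<Rightarrow> 'f::field) \<Rightarrow> 'f \<Rightarrow> 'f divisor \<Rightarrow> 'k" where
  "value_at \<iota> f F = (\<Prod>P\<in>supp F. residue_norm \<iota> P f powi F P)"

text \<open>Points of \<open>J(K) = Pic\<^sup>0(C)\<close> are linear equivalence classes, as sets of divisors.\<close>

definition pic_class :: "('k::field \<Rightarrow> 'f::field) \<Rightarrow> 'f divisor \<Rightarrow> 'f divisor set" where
  "pic_class \<iota> D = {D' \<in> divisors \<iota>. \<exists>f. f \<noteq> 0 \<and> D' = D + principal_divisor \<iota> f}"

definition jacobian :: "('k::field \<Rightarrow> 'f::field) \<Rightarrow> 'f divisor set set" where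
  "jacobian \<iota> = pic_class \<iota> ` divisors0 \<iota>"

definition pic_add :: "'f divisor set \<Rightarrow> 'f divisor set \<Rightarrow> 'f divisor set" where
  "pic_add x y = {D + E | D E. D \<in> x \<and> E \<in> y}"

definition pic_neg :: "'f divisor set \<Rightarrow> 'f divisor set" where
  "pic_neg x = uminus ` x"

section \<open>Line bundles\<close>

text \<open>
  A line bundle on \<open>C\<close> is given by the one-dimensional \<open>F\<close>-vector space of its meromorphic sections
  and, for each closed point \<open>P\<close>, its stalk at \<open>P\<close>, a free module of rank one over the local ring.
\<close>

record ('f, 'm) lbundle =
  mero :: "'m set"
  scal :: "'f \<Rightarrow> 'm \<Rightarrow> 'm"
  stalk :: "'f set \<Rightarrow> 'm set"

definition generates_at :: "('f::field, 'm::ab_group_add) lbundle \<Rightarrow> 'f point \<Rightarrow> 'm \<Rightarrow> bool" where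
  "generates_at M P e \<longleftrightarrow> e \<in> mero M \<and> e \<noteq> 0 \<and> stalk M P = (\<lambda>c. scal M c e) ` P"

definition line_bundle ::
  "('k::field \<Rightarrow> 'f::field) \<Rightarrow> ('f, 'm::ab_group_add) lbundle \<Rightarrow> bool" where
  "line_bundle \<iota> M \<longleftrightarrow>
     0 \<in> mero M \<and>
     (\<forall>m\<in>mero M. \<forall>n\<in>mero M. m + n \<in> mero M) \<and>
     (\<forall>c. \<forall>m\<in>mero M. scal M c m \<in> mero M \<and> scal M 1 m = m) \<and>
     (\<forall>c. \<forall>m\<in>mero M. \<forall>n\<in>mero M. scal M c (m + n) = scal M c m + scal M c n) \<and>
     (\<forall>c d. \<forall>m\<in>mero M. scal M (c + d) m = scal M c m + scal M d m \<and>
                        scal M (c * d) m = scal M c (scal M d m)) \<and>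
     (\<exists>e\<in>mero M. e \<noteq> 0 \<and> mero M = range (\<lambda>c. scal M c e)) \<and>
     (\<forall>P\<in>closed_points \<iota>. \<exists>e. generates_at M P e) \<and>
     (\<exists>e\<in>mero M. finite {P \<in> closed_points \<iota>. \<not> generates_at M P e})"

definition bundle_div ::
  "('k::field \<Rightarrow> 'f::field) \<Rightarrow> ('f, 'm::ab_group_add) lbundle \<Rightarrow> 'm \<Rightarrow> 'f divisor" where
  "bundle_div \<iota> M s = (\<lambda>P. if P \<in> closed_points \<iota>
     then THE n. \<exists>e h. generates_at M P e \<and> s = scal M h e \<and> n = ord_at P h else 0)"

text \<open>The degree is the common degree of the divisors of all nonzero meromorphic sections.\<close>

definition has_degree ::
  "('k::field \<Rightarrow> 'f::field) \<Rightarrow> ('f, 'm::ab_group_add) lbundle \<Rightarrow> int \<Rightarrow> bool" where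
  "has_degree \<iota> M d \<longleftrightarrow>
     (\<forall>s\<in>mero M. s \<noteq> 0 \<longrightarrow> bundle_div \<iota> M s \<in> divisors \<iota> \<and> div_degree \<iota> (bundle_div \<iota> M s) = d)"

definition global_sections ::
  "('k::field \<Rightarrow> 'f::field) \<Rightarrow> ('f, 'm::ab_group_add) lbundle \<Rightarrow> 'm set" where
  "global_sections \<iota> M = {s \<in> mero M. \<forall>P\<in>closed_points \<iota>. s \<in> stalk M P}"

definition section_ratio :: "('f::field, 'm::ab_group_add) lbundle \<Rightarrow> 'm \<Rightarrow> 'm \<Rightarrow> 'f" where
  "section_ratio M s t = (THE h. s = scal M h t)"

definition divisor_bundle :: "'f::field divisor \<Rightarrow> ('f, 'f) lbundle" where
  "divisor_bundle E =
     \<lparr>mero = UNIV, scal = (*), stalk = (\<lambda>P. {f. f = 0 \<or> 0 \<le> ord_at P f + E P})\<rparr>"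

definition dual_bundle ::
  "('f::field, 'm::ab_group_add) lbundle \<Rightarrow> ('f, 'm \<Rightarrow> 'f) lbundle" where
  "dual_bundle M =
     (let lin = {\<phi>. (\<forall>m\<in>mero M. \<forall>n\<in>mero M. \<phi> (m + n) = \<phi> m + \<phi> n) \<and>
                    (\<forall>c. \<forall>m\<in>mero M. \<phi> (scal M c m) = c * \<phi> m) \<and> (\<forall>m. m \<notin> mero M \<longrightarrow> \<phi> m = 0)}
      in \<lparr>mero = lin, scal = (\<lambda>c \<phi> m. c * \<phi> m),
          stalk = (\<lambda>P. {\<phi> \<in> lin. \<forall>m\<in>stalk M P. \<phi> m \<in> P})\<rparr>)"

text \<open>The twist \<open>M(D)\<close>.\<close>

definition twist ::
  "('f::field, 'm::ab_group_add) lbundle \<Rightarrow> 'f divisor \<Rightarrow> ('f, 'm) lbundle" where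
  "twist M D = M\<lparr>stalk := (\<lambda>P. {scal M f m | f m. m \<in> stalk M P \<and> (f = 0 \<or> 0 \<le> ord_at P f + D P)})\<rparr>"

text \<open>
  \<open>tensor_product \<iota> M N T \<mu>\<close>: the line bundle \<open>T\<close>, with the bilinear map \<open>\<mu>\<close>, is the tensor
  product of the line bundles \<open>M\<close> and \<open>N\<close>.
\<close>

definition tensor_product ::
  "('k::field \<Rightarrow> 'f::field) \<Rightarrow> ('f, 'm::ab_group_add) lbundle \<Rightarrow> ('f, 'n::ab_group_add) lbundle \<Rightarrow>
     ('f, 't::ab_group_add) lbundle \<Rightarrow> ('m \<Rightarrow> 'n \<Rightarrow> 't) \<Rightarrow> bool" where
  "tensor_product \<iota> M N T \<mu> \<longleftrightarrow> line_bundle \<iota> T \<and>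
     (\<forall>m\<in>mero M. \<forall>n\<in>mero N. \<mu> m n \<in> mero T) \<and>
     (\<forall>m\<in>mero M. \<forall>m'\<in>mero M. \<forall>n\<in>mero N. \<mu> (m + m') n = \<mu> m n + \<mu> m' n) \<and>
     (\<forall>m\<in>mero M. \<forall>n\<in>mero N. \<forall>n'\<in>mero N. \<mu> m (n + n') = \<mu> m n + \<mu> m n') \<and>
     (\<forall>c. \<forall>m\<in>mero M. \<forall>n\<in>mero N.
        \<mu> (scal M c m) n = scal T c (\<mu> m n) \<and> \<mu> m (scal N c n) = scal T c (\<mu> m n)) \<and>
     (\<forall>P\<in>closed_points \<iota>. \<forall>m n.
        generates_at M P m \<and> generates_at N P n \<longrightarrow> generates_at T P (\<mu> m n))"

text \<open>
  The point of the Picard group given by a line bundle: the linear equivalence class formed by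
  the divisors of its nonzero meromorphic sections.
\<close>

definition bundle_class ::
  "('k::field \<Rightarrow> 'f::field) \<Rightarrow> ('f, 'm::ab_group_add) lbundle \<Rightarrow> 'f divisor set" where
  "bundle_class \<iota> M = {bundle_div \<iota> M s | s. s \<in> mero M \<and> s \<noteq> 0}"

section \<open>Norms of line bundles along divisors\<close>

text \<open>The class of \<open>m\<close> in the fibre of \<open>M\<close> at \<open>P\<close>, as a coset.\<close>

definition fibre_elt :: "('f::field, 'm::ab_group_add) lbundle \<Rightarrow> 'f point \<Rightarrow> 'm \<Rightarrow> 'm set" where
  "fibre_elt M P m = {m + scal M c n | c n. c \<in> max_ideal P \<and> n \<in> stalk M P}"

text \<open>
  For \<open>F = \<Sum> n\<^sub>P P\<close>, elements of \<open>N\<^sub>F(M)\<close> are represented by pairs \<open>(c, \<phi>)\<close> with \<open>\<phi> P\<close> a nonzero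
  vector of the fibre at each point \<open>P\<close> of the support of \<open>F\<close>. The pair stands for the scalar \<open>c\<close>
  times the tensor product of the \<open>Norm(\<phi> P)\<close> to the powers \<open>n\<^sub>P\<close>. Since \<open>Norm(a v) = N(a) Norm(v)\<close> for \<open>a\<close>
  in the residue field, the pairs \<open>(c, (u\<^sub>P v\<^sub>P)\<^sub>P)\<close> and \<open>(c \<Prod> N(u\<^sub>P)\<^sup>n\<^sup>P, (v\<^sub>P)\<^sub>P)\<close> are identified.
\<close>

type_synonym ('k, 'f, 'm) norm_elt = "('k \<times> ('f point \<Rightarrow> 'm set)) set"

definition norm_reps ::
  "('f::field, 'm::ab_group_add) lbundle \<Rightarrow> 'f divisor \<Rightarrow> ('k::field, 'f, 'm) norm_elt" where
  "norm_reps M F = {(c, \<phi>). \<forall>P\<in>supp F. \<exists>m. generates_at M P m \<and> \<phi> P = fibre_elt M P m}"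

definition norm_class ::
  "('k::field \<Rightarrow> 'f::field) \<Rightarrow> ('f, 'm::ab_group_add) lbundle \<Rightarrow> 'f divisor \<Rightarrow>
     'k \<times> ('f point \<Rightarrow> 'm set) \<Rightarrow> ('k, 'f, 'm) norm_elt" where
  "norm_class \<iota> M F = (\<lambda>(c, \<phi>). {(c', \<phi>') \<in> norm_reps M F.
     \<exists>u. (\<forall>P\<in>supp F. unit_at P (u P) \<and> \<phi> P = scal M (u P) ` \<phi>' P) \<and>
         c' = c * (\<Prod>P\<in>supp F. residue_norm \<iota> P (u P) powi F P)})"

text \<open>\<open>N\<^sub>F(M)\<close> without its zero element.\<close>

definition norm_torsor ::
  "('k::field \<Rightarrow> 'f::field) \<Rightarrow> ('f, 'm::ab_group_add) lbundle \<Rightarrow> 'f divisor \<Rightarrow>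
     ('k, 'f, 'm) norm_elt set" where
  "norm_torsor \<iota> M F = norm_class \<iota> M F ` {(c, \<phi>) \<in> norm_reps M F. c \<noteq> 0}"

definition norm_scale :: "'k::field \<Rightarrow> ('k, 'f, 'm) norm_elt \<Rightarrow> ('k, 'f, 'm) norm_elt" where
  "norm_scale a \<nu> = (\<lambda>(c, \<phi>). (a * c, \<phi>)) ` \<nu>"

text \<open>The norm of a meromorphic section that generates \<open>M\<close> around the support of \<open>F\<close>.\<close>

definition norm_section ::
  "('k::field \<Rightarrow> 'f::field) \<Rightarrow> ('f, 'm::ab_group_add) lbundle \<Rightarrow> 'f divisor \<Rightarrow> 'm \<Rightarrow>
     ('k, 'f, 'm) norm_elt" where
  "norm_section \<iota> M F s = norm_class \<iota> M F (1, \<lambda>P. fibre_elt M P s)"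

text \<open>Functoriality in the line bundle, for an isomorphism given by \<open>g\<close> on meromorphic sections.\<close>

definition norm_map ::
  "('m \<Rightarrow> 'n) \<Rightarrow> ('k::field, 'f, 'm) norm_elt \<Rightarrow> ('k, 'f, 'n) norm_elt" where
  "norm_map g \<nu> = (\<lambda>(c, \<phi>). (c, \<lambda>P. g ` \<phi> P)) ` \<nu>"

text \<open>The canonical isomorphism from \<open>N\<^sub>F(M) \<otimes> N\<^sub>G(M)\<close> to \<open>N\<^sub>F\<^sub>+\<^sub>G(M)\<close>.\<close>

definition norm_mult ::
  "('k::field \<Rightarrow> 'f::field) \<Rightarrow> ('f, 'm::ab_group_add) lbundle \<Rightarrow> 'f divisor \<Rightarrow> 'f divisor \<Rightarrow>
     ('k, 'f, 'm) norm_elt \<Rightarrow> ('k, 'f, 'm) norm_elt \<Rightarrow> ('k, 'f, 'm) norm_elt" where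
  "norm_mult \<iota> M F G \<nu> \<nu>' =
     \<Union> {norm_class \<iota> M (F + G) (c * c', \<phi>) | c c' \<phi>. (c, \<phi>) \<in> \<nu> \<and> (c', \<phi>) \<in> \<nu>'}"

text \<open>
  The element of \<open>N\<^sub>0(M)\<close> corresponding to a scalar. The support of the zero divisor is empty, so
  the second component of a representative carries no information.
\<close>

definition norm_const ::
  "('k::field \<Rightarrow> 'f::field) \<Rightarrow> ('f, 'm::ab_group_add) lbundle \<Rightarrow> 'k \<Rightarrow> ('k, 'f, 'm) norm_elt" where
  "norm_const \<iota> M c = norm_class \<iota> M 0 (c, \<lambda>_. {})"

section \<open>The Poincare torsor\<close>

text \<open>
  A triple \<open>(D, E, \<nu>)\<close> with \<open>\<nu>\<close> a nonzero element of \<open>N\<^sub>D(O\<^sub>C(E))\<close> represents a point over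
  \<open>([D], [E])\<close>. The points of the torsor are the classes of the equivalence relation generated by
  the two kinds of identifications.
\<close>

type_synonym ('k, 'f) poincare_rep = "'f divisor \<times> 'f divisor \<times> ('k, 'f, 'f) norm_elt"

definition poincare_reps :: "('k::field \<Rightarrow> 'f::field) \<Rightarrow> ('k, 'f) poincare_rep set" where
  "poincare_reps \<iota> = {(D, E, \<nu>). D \<in> divisors0 \<iota> \<and> E \<in> divisors0 \<iota> \<and>
                                  \<nu> \<in> norm_torsor \<iota> (divisor_bundle E) D}"

inductive poincare_step ::
  "('k::field \<Rightarrow> 'f::field) \<Rightarrow> ('k, 'f) poincare_rep \<Rightarrow> ('k, 'f) poincare_rep \<Rightarrow> bool"
  for \<iota> where
  change_E:
    "\<lbrakk>f \<noteq> 0; E \<in> divisors0 \<iota>;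
      (D, E + principal_divisor \<iota> f, \<nu>) \<in> poincare_reps \<iota>\<rbrakk>
     \<Longrightarrow> poincare_step \<iota> (D, E + principal_divisor \<iota> f, \<nu>) (D, E, norm_map ((*) f) \<nu>)"
| change_D:
    "\<lbrakk>f \<noteq> 0; s \<noteq> 0; a \<noteq> 0;
      D \<in> divisors0 \<iota>; D + principal_divisor \<iota> f \<in> divisors0 \<iota>; E \<in> divisors0 \<iota>;
      disjoint_divisors (bundle_div \<iota> (divisor_bundle E) s) D;
      disjoint_divisors (bundle_div \<iota> (divisor_bundle E) s) (principal_divisor \<iota> f)\<rbrakk>
     \<Longrightarrow> poincare_step \<iota>
           (D + principal_divisor \<iota> f, E,
            norm_scale a (norm_section \<iota> (divisor_bundle E) (D + principal_divisor \<iota> f) s))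
           (D, E,
            norm_scale (a * value_at \<iota> f (bundle_div \<iota> (divisor_bundle E) s))
              (norm_section \<iota> (divisor_bundle E) D s))"

type_synonym ('k, 'f) poincare_point = "('k, 'f) poincare_rep set"

definition poincare_class ::
  "('k::field \<Rightarrow> 'f::field) \<Rightarrow> ('k, 'f) poincare_rep \<Rightarrow> ('k, 'f) poincare_point" where
  "poincare_class \<iota> t = {t'. equivclp (poincare_step \<iota>) t t'}"

definition poincare_fibre ::
  "('k::field \<Rightarrow> 'f::field) \<Rightarrow> 'f divisor set \<Rightarrow> 'f divisor set \<Rightarrow> ('k, 'f) poincare_point set" where
  "poincare_fibre \<iota> x y =
     {poincare_class \<iota> (D, E, \<nu>) | D E \<nu>. D \<in> x \<and> E \<in> y \<and> (D, E, \<nu>) \<in> poincare_reps \<iota>}"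

definition poincare_scale ::
  "'k::field \<Rightarrow> ('k, 'f) poincare_point \<Rightarrow> ('k, 'f) poincare_point" where
  "poincare_scale a \<pi> = (\<lambda>(D, E, \<nu>). (D, E, norm_scale a \<nu>)) ` \<pi>"

text \<open>The point \<open>(D, E)\<close> attached to divisors of degree zero with disjoint supports.\<close>

definition pair_point ::
  "('k::field \<Rightarrow> 'f::field) \<Rightarrow> 'f divisor \<Rightarrow> 'f divisor \<Rightarrow> ('k, 'f) poincare_point" where
  "pair_point \<iota> D E = poincare_class \<iota> (D, E, norm_section \<iota> (divisor_bundle E) D 1)"

text \<open>
  The left partial group law as a relation: \<open>left_product \<iota> \<pi> \<pi>' \<pi>''\<close> says that \<open>\<pi>''\<close> is the
  product of \<open>\<pi>\<close> and \<open>\<pi>'\<close>. Relations are used here and for inverses because the existence of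
  unique values rests on Weil reciprocity, which makes the identifications consistent.
\<close>

definition left_product ::
  "('k::field \<Rightarrow> 'f::field) \<Rightarrow> ('k, 'f) poincare_point \<Rightarrow> ('k, 'f) poincare_point \<Rightarrow>
     ('k, 'f) poincare_point \<Rightarrow> bool" where
  "left_product \<iota> \<pi> \<pi>' \<pi>'' \<longleftrightarrow>
     (\<exists>D D' E \<nu> \<nu>'. (D, E, \<nu>) \<in> poincare_reps \<iota> \<and> (D', E, \<nu>') \<in> poincare_reps \<iota> \<and>
        \<pi> = poincare_class \<iota> (D, E, \<nu>) \<and> \<pi>' = poincare_class \<iota> (D', E, \<nu>') \<and>
        \<pi>'' = poincare_class \<iota> (D + D', E, norm_mult \<iota> (divisor_bundle E) D D' \<nu> \<nu>'))"

text \<open>The point over \<open>(0, y)\<close> corresponding to \<open>c\<close> under the canonical trivialisation.\<close>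

definition trivialised ::
  "('k::field \<Rightarrow> 'f::field) \<Rightarrow> 'f divisor set \<Rightarrow> ('k, 'f) poincare_point \<Rightarrow> 'k \<Rightarrow> bool" where
  "trivialised \<iota> y \<pi> c \<longleftrightarrow>
     (\<exists>E\<in>y. \<pi> = poincare_class \<iota> (0, E, norm_const \<iota> (divisor_bundle E) c))"

text \<open>\<open>\<rho>\<close> is the inverse, for the left partial group law, of the point \<open>\<pi>\<close> over \<open>(x, y)\<close>.\<close>

definition left_inverse ::
  "('k::field \<Rightarrow> 'f::field) \<Rightarrow> 'f divisor set \<Rightarrow> 'f divisor set \<Rightarrow>
     ('k, 'f) poincare_point \<Rightarrow> ('k, 'f) poincare_point \<Rightarrow> bool" where
  "left_inverse \<iota> x y \<pi> \<rho> \<longleftrightarrow>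
     \<pi> \<in> poincare_fibre \<iota> x y \<and> \<rho> \<in> poincare_fibre \<iota> (pic_neg x) y \<and>
     (\<exists>\<epsilon>. left_product \<iota> \<pi> \<rho> \<epsilon> \<and> trivialised \<iota> y \<epsilon> 1)"

end

theory Submission
  imports Defs
begin

text \<open>
  Let \<open>h = s / d\<^sub>0\<^sup>2\<close>, so that \<open>(D - D\<^sub>0) + (D' - D\<^sub>0) = (h)\<close>. Multiplying
  \<open>(D - D\<^sub>0, E - E\<^sub>0)\<close> by \<open>\<lambda>\<close> times \<open>(D' - D\<^sub>0, E - E\<^sub>0)\<close> therefore gives \<open>\<lambda>\<close> times the norm of the
  section \<open>1\<close> along \<open>(h)\<close>, which identification (ii), for the zero divisor and the function \<open>h\<close>, turns into
  the scalar \<open>\<lambda> h(E - E\<^sub>0) = 1\<close> in the fibre over \<open>(0, y)\<close>. Principal divisors are finite of degree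
  zero because the divisors of \<open>m\<close> and \<open>f m\<close> have the same degree for a meromorphic section \<open>m\<close>
  of the line bundle \<open>L\<close>, which is assumed to have a degree.
\<close>

section \<open>Closed points as discrete valuation rings\<close>

text \<open>Inverses for the left group law are a relation, so the claim is existential:
  representatives of the two points have to be exhibited over one and the same second divisor, with
  a product identified with the scalar 1. The divisor \<open>E - E0\<close> and the section
  \<open>1\<close> serve throughout. Since \<open>1\<close> generates the bundle of
  \<open>E - E0\<close> along both \<open>D - D0\<close> and \<open>D' - D0\<close>, the two norms
  are carried by one family of cosets and only scalars get multiplied. The constant is
  \<open>1 / h(E - E0)\<close>, spelled out as \<open>h(E0)\<close> times \<open>(1/h)(E)\<close>.

  The obstacle is that the basic notions are given by descriptions and choices: orders through some
  uniformizer, divisors of sections through some local generator, residue norms through a chosen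
  basis, norm elements as classes of pairs. Most of the work shows that nothing depends on these
  choices. The delicate point is that a scalar acting on a fibre is known only modulo the maximal
  ideal, so products of norm elements are well defined because residue norms depend only on
  residues.\<close>

lemma unit_at_inverse: "unit_at P u \<Longrightarrow> unit_at P (inverse u)"
  by (simp add: unit_at_def)

context
  fixes \<iota> :: "'k::field \<Rightarrow> 'f::field" and P :: "'f point"
  assumes P: "P \<in> closed_points \<iota>"
begin

lemma closed_point_add: "f \<in> P \<Longrightarrow> g \<in> P \<Longrightarrow> f + g \<in> P"
  and closed_point_mult: "f \<in> P \<Longrightarrow> g \<in> P \<Longrightarrow> f * g \<in> P"
  and closed_point_uminus: "f \<in> P \<Longrightarrow> - f \<in> P"
  and closed_point_scalar: "\<iota> c \<in> P"
  using P by (auto simp: closed_points_def)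

lemma closed_point_diff: "f \<in> P \<Longrightarrow> g \<in> P \<Longrightarrow> f - g \<in> P"
  using closed_point_add[of f "- g"] closed_point_uminus[of g] by simp

lemma unit_at_mult: "unit_at P u \<Longrightarrow> unit_at P v \<Longrightarrow> unit_at P (u * v)"
  by (auto simp: unit_at_def closed_point_mult)

lemma uniformizer_ex: "\<exists>t. uniformizer_at P t"
  using P by (simp add: closed_points_def)

text \<open>Here \<open>\<iota>\<close> is only a function, so \<open>1\<close> cannot be obtained
  as the image of \<open>1\<close>. Factoring \<open>1\<close> through a uniformizer produces some
  unit \<open>u\<close>, and \<open>u * inverse u\<close> lies in \<open>P\<close>.\<close>

lemma closed_point_one: "1 \<in> P"
proof -
  obtain t where "uniformizer_at P t"
    using uniformizer_ex by blast
  then obtain n u where "unit_at P u" "1 = t powi n * u"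
    unfolding uniformizer_at_def by (metis zero_neq_one)
  then have "u * inverse u \<in> P" "u \<noteq> 0"
    unfolding unit_at_def by (blast intro: closed_point_mult)+
  then show ?thesis by simp
qed

lemma closed_point_zero: "0 \<in> P"
  using closed_point_diff[OF closed_point_one closed_point_one] by simp

lemma unit_at_one: "unit_at P 1"
  by (simp add: unit_at_def closed_point_one)

lemma closed_point_power: "f \<in> P \<Longrightarrow> f ^ n \<in> P"
  by (induction n) (auto simp: closed_point_one closed_point_mult)

lemma unit_at_powi: "unit_at P u \<Longrightarrow> unit_at P (u powi n)"
  by (auto simp: unit_at_def power_int_def closed_point_power simp flip: power_inverse)

section \<open>Uniformizers and the order of vanishing\<close>

lemma uniformizer_powi_mem_iff:
  assumes t: "uniformizer_at P t"
  shows "t powi n \<in> P \<longleftrightarrow> 0 \<le> n"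
proof
  assume n: "t powi n \<in> P"
  show "0 \<le> n"
  proof (rule ccontr)
    assume "\<not> 0 \<le> n"
    \<comment> \<open>The exponent \<open>- n - 1\<close> is nonnegative and is chosen so that
      multiplying by \<open>t powi n\<close> leaves exactly \<open>inverse t\<close>, which is not
      in \<open>P\<close>.\<close>
    then have "t powi (- n - 1) \<in> P"
      using t by (simp add: power_int_def closed_point_power uniformizer_at_def)
    with n have "t powi n * t powi (- n - 1) \<in> P"
      by (rule closed_point_mult)
    moreover have "t powi n * t powi (- n - 1) = inverse t"
      using t by (simp add: uniformizer_at_def power_int_minus flip: power_int_add)
    ultimately show False
      using t by (simp add: uniformizer_at_def)
  qed
next
  assume "0 \<le> n"
  then show "t powi n \<in> P"
    using t by (simp add: power_int_def closed_point_power uniformizer_at_def)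
qed

lemma uniformizer_powi_unit_iff:
  assumes t: "uniformizer_at P t"
  shows "unit_at P (t powi n) \<longleftrightarrow> n = 0"
  using uniformizer_powi_mem_iff[OF t, of n] uniformizer_powi_mem_iff[OF t, of "- n"] t
  by (auto simp: unit_at_def uniformizer_at_def power_int_minus)

lemma uniformizer_powi_unit_unique:
  assumes t: "uniformizer_at P t" and u: "unit_at P u" and v: "unit_at P v"
    and eq: "t powi m * u = t powi n * v"
  shows "m = n"
proof -
  have t0: "t \<noteq> 0" using t by (simp add: uniformizer_at_def)
  have "t powi (m - n) = v * inverse u"
    using eq t0 u by (simp add: power_int_diff unit_at_def field_simps)
  moreover have "unit_at P (v * inverse u)"
    by (intro unit_at_mult unit_at_inverse u v)
  ultimately show ?thesis
    using uniformizer_powi_unit_iff[OF t, of "m - n"] by simp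
qed

text \<open>Each uniformizer is a power of the other times a unit, and the two exponents multiply to
  1, so both are 1 or both are -1. The sign -1 would put \<open>inverse t'\<close> into
  \<open>P\<close>.\<close>

lemma uniformizer_unique:
  assumes t: "uniformizer_at P t" and t': "uniformizer_at P t'"
  shows "\<exists>u. unit_at P u \<and> t' = t * u"
proof -
  have t0: "t \<noteq> 0" "t' \<noteq> 0" using t t' by (auto simp: uniformizer_at_def)
  obtain n u where u: "unit_at P u" and n: "t' = t powi n * u"
    using t t0 unfolding uniformizer_at_def by metis
  obtain m v where v: "unit_at P v" and m: "t = t' powi m * v"
    using t' t0 unfolding uniformizer_at_def by metis
  have "t powi 1 * 1 = t powi (n * m) * (u powi m * v)"
    using m unfolding n by (simp add: power_int_mult_distrib power_int_mult mult.assoc)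
  then have "1 = n * m"
    using uniformizer_powi_unit_unique[OF t unit_at_one] u v
    by (blast intro: unit_at_mult unit_at_powi)
  then have "n = 1 \<or> n = - 1"
    by (metis zmult_eq_1_iff)
  moreover have "n \<noteq> - 1"
  proof
    assume "n = - 1"
    then have "inverse t' = t * inverse u"
      using n by (simp add: power_int_minus)
    then show False
      using t t' u by (metis closed_point_mult uniformizer_at_def unit_at_def)
  qed
  ultimately show ?thesis using n u by auto
qed

text \<open>The description in \<open>ord_at\<close> allows any uniformizer, so uniqueness has to
  survive a change of \<open>t\<close>: another one is \<open>t * v\<close> with \<open>v\<close> a
  unit, and powers of \<open>v\<close> are absorbed into the unit factor.\<close>

lemma ord_at_powi_mult_unit:
  assumes t: "uniformizer_at P t" and u: "unit_at P u"
  shows "ord_at P (t powi n * u) = n"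
  unfolding ord_at_def
proof (rule the_equality)
  show "\<exists>t' u'. uniformizer_at P t' \<and> unit_at P u' \<and> t powi n * u = t' powi n * u'"
    using t u by blast
next
  fix m
  assume "\<exists>t' u'. uniformizer_at P t' \<and> unit_at P u' \<and> t powi n * u = t' powi m * u'"
  then obtain t' u' where *: "uniformizer_at P t'" "unit_at P u'"
    "t powi n * u = t' powi m * u'" by blast
  obtain v where v: "unit_at P v" "t' = t * v"
    using uniformizer_unique[OF t *(1)] by blast
  then have "t powi n * u = t powi m * (v powi m * u')"
    using * by (simp add: power_int_mult_distrib mult.assoc)
  then show "m = n"
    using uniformizer_powi_unit_unique[OF t u] v * by (metis unit_at_mult unit_at_powi)
qed

lemma ord_at_decomp:
  assumes t: "uniformizer_at P t" and f: "f \<noteq> 0"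
  obtains u where "unit_at P u" "f = t powi ord_at P f * u"
proof -
  obtain n u where "unit_at P u" "f = t powi n * u"
    using t f unfolding uniformizer_at_def by metis
  then show ?thesis
    using that[of u] ord_at_powi_mult_unit[OF t, of u n] by simp
qed

lemma ord_at_mult:
  assumes "f \<noteq> 0" "g \<noteq> 0"
  shows "ord_at P (f * g) = ord_at P f + ord_at P g"
proof -
  obtain t where t: "uniformizer_at P t" using uniformizer_ex by blast
  obtain u where u: "unit_at P u" "f = t powi ord_at P f * u"
    by (rule ord_at_decomp[OF t assms(1)])
  obtain v where v: "unit_at P v" "g = t powi ord_at P g * v"
    by (rule ord_at_decomp[OF t assms(2)])
  have t0: "t \<noteq> 0" using t by (simp add: uniformizer_at_def)
  have "f * g = (t powi ord_at P f * u) * (t powi ord_at P g * v)"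
    using u v by argo
  also have "\<dots> = t powi (ord_at P f + ord_at P g) * (u * v)"
    using t0 by (simp add: power_int_add)
  finally show ?thesis
    using ord_at_powi_mult_unit[OF t unit_at_mult[OF u(1) v(1)]] by metis
qed

lemma unit_at_iff_ord: "f \<noteq> 0 \<Longrightarrow> unit_at P f \<longleftrightarrow> ord_at P f = 0"
proof -
  assume f: "f \<noteq> 0"
  obtain t where t: "uniformizer_at P t" using uniformizer_ex by blast
  obtain u where u: "unit_at P u" "f = t powi ord_at P f * u"
    by (rule ord_at_decomp[OF t f])
  show ?thesis
    using ord_at_powi_mult_unit[OF t, of f 0] u by auto
qed

lemma ord_at_one: "ord_at P 1 = 0"
  using unit_at_iff_ord[of 1] unit_at_one by simp

lemma ord_at_inverse: "f \<noteq> 0 \<Longrightarrow> ord_at P (inverse f) = - ord_at P f"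
  using ord_at_mult[of f "inverse f"] ord_at_one by simp

lemma ord_at_uniformizer_powi: "uniformizer_at P t \<Longrightarrow> ord_at P (t powi n) = n"
  using ord_at_powi_mult_unit[OF _ unit_at_one, of t n] by simp

lemma mem_iff_ord_at_nonneg: "f \<noteq> 0 \<Longrightarrow> f \<in> P \<longleftrightarrow> 0 \<le> ord_at P f"
proof -
  assume f: "f \<noteq> 0"
  obtain t where t: "uniformizer_at P t" using uniformizer_ex by blast
  obtain u where u: "unit_at P u" "f = t powi ord_at P f * u"
    by (rule ord_at_decomp[OF t f])
  have "f \<in> P \<longleftrightarrow> t powi ord_at P f \<in> P"
  proof
    assume "f \<in> P"
    then have "f * inverse u \<in> P"
      using u(1) by (simp add: unit_at_def closed_point_mult)
    moreover have "f * inverse u = t powi ord_at P f"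
      by (subst u(2)) (use u(1) in \<open>simp add: unit_at_def\<close>)
    ultimately show "t powi ord_at P f \<in> P" by simp
  next
    assume "t powi ord_at P f \<in> P"
    then show "f \<in> P"
      using u by (metis closed_point_mult unit_at_def)
  qed
  then show ?thesis
    using uniformizer_powi_mem_iff[OF t] by simp
qed

text \<open>Nonunits are not visibly closed under addition. Writing them as the multiples of a
  uniformizer makes the ideal laws immediate.\<close>

lemma max_ideal_eq_image:
  assumes t: "uniformizer_at P t"
  shows "max_ideal P = (*) t ` P"
proof (intro equalityI subsetI)
  have t0: "t \<noteq> 0" using t by (simp add: uniformizer_at_def)
  have ordt: "ord_at P t = 1"
    using ord_at_uniformizer_powi[OF t, of 1] by simp
  fix f
  assume f: "f \<in> max_ideal P"
  show "f \<in> (*) t ` P"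
  proof (cases "f = 0")
    case True
    then show ?thesis using closed_point_zero by force
  next
    case False
    then have "0 \<le> ord_at P f" "ord_at P f \<noteq> 0"
      using f by (auto simp: max_ideal_def mem_iff_ord_at_nonneg unit_at_iff_ord)
    then have "0 \<le> ord_at P (f * inverse t)"
      using False t0 by (simp add: ord_at_mult ord_at_inverse ordt)
    then have "f * inverse t \<in> P"
      using False t0 by (simp add: mem_iff_ord_at_nonneg)
    moreover have "f = t * (f * inverse t)" using t0 by simp
    ultimately show ?thesis by blast
  qed
next
  have tP: "t \<in> P" "t \<noteq> 0" "inverse t \<notin> P" using t by (auto simp: uniformizer_at_def)
  fix f
  assume "f \<in> (*) t ` P"
  then obtain g where g: "g \<in> P" "f = t * g" by blast
  have "\<not> unit_at P f"
  proof
    assume u: "unit_at P f"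
    then have "g * inverse f \<in> P" using g by (simp add: unit_at_def closed_point_mult)
    moreover have "g * inverse f = inverse t"
      using u g tP by (auto simp: unit_at_def field_simps)
    ultimately show False using tP by simp
  qed
  then show "f \<in> max_ideal P"
    using g tP by (simp add: max_ideal_def closed_point_mult)
qed

lemma max_ideal_add: "f \<in> max_ideal P \<Longrightarrow> g \<in> max_ideal P \<Longrightarrow> f + g \<in> max_ideal P"
  and max_ideal_mult: "f \<in> max_ideal P \<Longrightarrow> a \<in> P \<Longrightarrow> a * f \<in> max_ideal P"
proof -
  obtain t where t: "uniformizer_at P t" using uniformizer_ex by blast
  show "f \<in> max_ideal P \<Longrightarrow> g \<in> max_ideal P \<Longrightarrow> f + g \<in> max_ideal P"
    unfolding max_ideal_eq_image[OF t]
    by (auto simp: image_iff closed_point_add simp flip: distrib_left)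
  show "f \<in> max_ideal P \<Longrightarrow> a \<in> P \<Longrightarrow> a * f \<in> max_ideal P"
    unfolding max_ideal_eq_image[OF t]
    by (auto simp: image_iff closed_point_mult mult.left_commute)
qed

lemma max_ideal_zero: "0 \<in> max_ideal P"
  by (simp add: max_ideal_def closed_point_zero unit_at_def)

lemma max_ideal_sum: "(\<And>i. i \<in> I \<Longrightarrow> f i \<in> max_ideal P) \<Longrightarrow> sum f I \<in> max_ideal P"
  by (induction I rule: infinite_finite_induct) (auto simp: max_ideal_zero max_ideal_add)

end

section \<open>Norms from residue fields\<close>

text \<open>For a fixed basis this is the matrix whose determinant \<open>residue_norm\<close>
  takes. Separating it from the choice of the basis lets the multiplicative laws be proved for
  matrices.\<close>

definition residue_matrix ::
  "('k::field \<Rightarrow> 'f::field) \<Rightarrow> 'f point \<Rightarrow> 'f list \<Rightarrow> 'f \<Rightarrow> 'k mat" where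
  "residue_matrix \<iota> P bs f = mat (length bs) (length bs)
     (\<lambda>(i, j). (THE cs. quotient_coords (\<lambda>c f. \<iota> c * f) (max_ideal P) bs (f * bs ! j) cs) ! i)"

context
  fixes \<iota> :: "'k::field \<Rightarrow> 'f::field" and P :: "'f point"
  assumes P: "P \<in> closed_points \<iota>" and hom: "field_hom \<iota>"
begin

interpretation \<iota>: field_hom \<iota> by (rule hom)

context
  fixes bs :: "'f list"
  assumes bs: "quotient_basis (\<lambda>c f. \<iota> c * f) P (max_ideal P) bs"
begin

private abbreviation coords where
  "coords \<equiv> quotient_coords (\<lambda>c f. \<iota> c * f) (max_ideal P) bs"

private abbreviation mult_mat where
  "mult_mat \<equiv> residue_matrix \<iota> P bs"

private lemma basis_mem: "i < length bs \<Longrightarrow> bs ! i \<in> P"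
  using bs by (auto simp: quotient_basis_def)

private lemma coords_the:
  assumes "v \<in> P"
  shows "coords v (THE cs. coords v cs)"
  by (rule theI') (use bs assms in \<open>auto simp: quotient_basis_def\<close>)

private lemma coords_unique: "v \<in> P \<Longrightarrow> coords v cs \<Longrightarrow> (THE cs. coords v cs) = cs"
  using bs by (auto simp: quotient_basis_def intro!: the1_equality)

lemma residue_matrix_col:
  assumes "f \<in> P" "j < length bs"
  shows "f * bs ! j - (\<Sum>i<length bs. \<iota> (mult_mat f $$ (i, j)) * bs ! i) \<in> max_ideal P"
proof -
  have "f * bs ! j \<in> P"
    using assms by (intro closed_point_mult[OF P] basis_mem)
  from coords_the[OF this] show ?thesis
    using assms by (simp add: quotient_coords_def residue_matrix_def)
qed

text \<open>Coordinates modulo the maximal ideal are unique, so congruences for the columns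
  determine the matrix. The identities below are checked through such congruences instead of the
  description in the definition.\<close>

lemma residue_matrix_eqI:
  assumes f: "f \<in> P" and A: "A \<in> carrier_mat (length bs) (length bs)"
    and eq: "\<And>j. j < length bs \<Longrightarrow>
      f * bs ! j - (\<Sum>i<length bs. \<iota> (A $$ (i, j)) * bs ! i) \<in> max_ideal P"
  shows "mult_mat f = A"
proof (rule eq_matI)
  fix i j assume ij: "i < dim_row A" "j < dim_col A"
  have "f * bs ! j \<in> P"
    using f ij A by (intro closed_point_mult[OF P] basis_mem) auto
  then have "(THE cs. coords (f * bs ! j) cs) = map (\<lambda>i. A $$ (i, j)) [0..<length bs]"
    by (rule coords_unique) (use eq[of j] ij A in \<open>simp add: quotient_coords_def\<close>)
  then show "mult_mat f $$ (i, j) = A $$ (i, j)"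
    using ij A by (simp add: residue_matrix_def)
qed (use A in \<open>auto simp: residue_matrix_def\<close>)

lemma residue_matrix_carrier: "mult_mat f \<in> carrier_mat (length bs) (length bs)"
  by (simp add: residue_matrix_def)

lemma residue_matrix_mult:
  assumes f: "f \<in> P" and g: "g \<in> P"
  shows "mult_mat (f * g) = mult_mat f * mult_mat g"
proof (rule residue_matrix_eqI)
  let ?n = "length bs"
  fix j assume j: "j < ?n"
  \<comment> \<open>The error of the product matrix is \<open>f\<close> times the error of
    \<open>g\<close> in column \<open>j\<close>, plus a combination of the errors of
    \<open>f\<close> in the columns \<open>k\<close> with entries of the matrix of \<open>g\<close>
    as coefficients. All these errors lie in the ideal.\<close>
  have *: "f * g * bs ! j - (\<Sum>i<?n. \<iota> ((mult_mat f * mult_mat g) $$ (i, j)) * bs ! i)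
    = f * (g * bs ! j - (\<Sum>k<?n. \<iota> (mult_mat g $$ (k, j)) * bs ! k))
      + (\<Sum>k<?n. \<iota> (mult_mat g $$ (k, j)) *
          (f * bs ! k - (\<Sum>i<?n. \<iota> (mult_mat f $$ (i, k)) * bs ! i)))"
  proof -
    have "(\<Sum>i<?n. \<iota> ((mult_mat f * mult_mat g) $$ (i, j)) * bs ! i)
      = (\<Sum>i<?n. \<Sum>k<?n. \<iota> (mult_mat g $$ (k, j)) * (\<iota> (mult_mat f $$ (i, k)) * bs ! i))"
      using j by (intro sum.cong refl)
        (auto simp: residue_matrix_def scalar_prod_def \<iota>.hom_sum \<iota>.hom_mult sum_distrib_right
          atLeast0LessThan intro!: sum.cong)
    also have "\<dots> = (\<Sum>k<?n. \<iota> (mult_mat g $$ (k, j)) * (\<Sum>i<?n. \<iota> (mult_mat f $$ (i, k)) * bs ! i))"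
      by (subst sum.swap) (simp add: sum_distrib_left)
    finally show ?thesis
      by (simp add: right_diff_distrib sum_subtractf sum_distrib_left mult_ac)
  qed
  show "f * g * bs ! j - (\<Sum>i<?n. \<iota> ((mult_mat f * mult_mat g) $$ (i, j)) * bs ! i) \<in> max_ideal P"
    unfolding *
    by (intro max_ideal_add[OF P] max_ideal_sum[OF P] max_ideal_mult[OF P] residue_matrix_col
        closed_point_scalar[OF P] f g j) auto
qed (use closed_point_mult[OF P f g] in \<open>auto simp: residue_matrix_def\<close>)

lemma residue_matrix_one: "mult_mat 1 = 1\<^sub>m (length bs)"
proof (rule residue_matrix_eqI)
  fix j assume j: "j < length bs"
  have "(\<Sum>i<length bs. \<iota> (1\<^sub>m (length bs) $$ (i, j)) * bs ! i)
    = (\<Sum>i<length bs. if i = j then bs ! i else 0)"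
    using j by (intro sum.cong) auto
  then show "1 * bs ! j - (\<Sum>i<length bs. \<iota> (1\<^sub>m (length bs) $$ (i, j)) * bs ! i) \<in> max_ideal P"
    using j by (simp add: max_ideal_zero[OF P])
qed (auto simp: closed_point_one[OF P])

lemma residue_matrix_cong:
  assumes f: "f \<in> P" and g: "g \<in> P" and fg: "f - g \<in> max_ideal P"
  shows "mult_mat f = mult_mat g"
proof (rule residue_matrix_eqI[OF f residue_matrix_carrier])
  fix j assume j: "j < length bs"
  have "bs ! j * (f - g) + (g * bs ! j - (\<Sum>i<length bs. \<iota> (mult_mat g $$ (i, j)) * bs ! i))
    \<in> max_ideal P"
    by (intro max_ideal_add[OF P] max_ideal_mult[OF P] residue_matrix_col fg basis_mem j g)
  then show "f * bs ! j - (\<Sum>i<length bs. \<iota> (mult_mat g $$ (i, j)) * bs ! i) \<in> max_ideal P"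
    by (simp add: algebra_simps)
qed

end

text \<open>The basis is chosen independently of \<open>f\<close>, so one matrix representation
  serves all functions and the laws follow from those of determinants. Without a basis the norm has
  the default value 1 for every \<open>f\<close>, which satisfies the laws as well.\<close>

lemma residue_norm_mult:
    "f \<in> P \<Longrightarrow> g \<in> P \<Longrightarrow> residue_norm \<iota> P (f * g) = residue_norm \<iota> P f * residue_norm \<iota> P g"
  and residue_norm_one: "residue_norm \<iota> P 1 = 1"
  and residue_norm_cong:
    "f \<in> P \<Longrightarrow> g \<in> P \<Longrightarrow> f - g \<in> max_ideal P \<Longrightarrow> residue_norm \<iota> P f = residue_norm \<iota> P g"
proof -
  let ?basis = "quotient_basis (\<lambda>c f. \<iota> c * f) P (max_ideal P)"
  consider (basis) bs where "?basis bs" "\<And>f. residue_norm \<iota> P f = det (residue_matrix \<iota> P bs f)"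
    | (trivial) "\<And>f. residue_norm \<iota> P f = 1"
  proof (cases "\<exists>bs. ?basis bs")
    case True
    then show ?thesis
      using that(1)[of "SOME bs. ?basis bs"] someI_ex[OF True]
      by (simp add: residue_norm_def residue_matrix_def Let_def)
  next
    case False
    then show ?thesis by (intro that(2)) (simp only: residue_norm_def Let_def if_False)
  qed
  note norm_cases = this
  show "f \<in> P \<Longrightarrow> g \<in> P \<Longrightarrow> residue_norm \<iota> P (f * g) = residue_norm \<iota> P f * residue_norm \<iota> P g"
    by (cases rule: norm_cases)
      (simp_all add: residue_matrix_mult det_mult[OF residue_matrix_carrier residue_matrix_carrier])
  show "residue_norm \<iota> P 1 = 1"
    by (cases rule: norm_cases) (simp_all add: residue_matrix_one)
  show "f \<in> P \<Longrightarrow> g \<in> P \<Longrightarrow> f - g \<in> max_ideal P \<Longrightarrow> residue_norm \<iota> P f = residue_norm \<iota> P g"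
    by (cases rule: norm_cases) (simp_all add: residue_matrix_cong[of _ f g])
qed

lemma residue_norm_inverse:
  assumes "unit_at P u"
  shows "residue_norm \<iota> P u \<noteq> 0" "residue_norm \<iota> P (inverse u) = inverse (residue_norm \<iota> P u)"
proof -
  have "residue_norm \<iota> P u * residue_norm \<iota> P (inverse u) = 1"
    using assms residue_norm_mult[of u "inverse u"] by (simp add: unit_at_def residue_norm_one)
  then show "residue_norm \<iota> P u \<noteq> 0" "residue_norm \<iota> P (inverse u) = inverse (residue_norm \<iota> P u)"
    by (auto simp: inverse_unique)
qed

end

section \<open>Divisors\<close>

lemma divisors_add: "D \<in> divisors \<iota> \<Longrightarrow> E \<in> divisors \<iota> \<Longrightarrow> D + E \<in> divisors \<iota>"
proof -
  assume "D \<in> divisors \<iota>" "E \<in> divisors \<iota>"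
  moreover have "supp (D + E) \<subseteq> supp D \<union> supp E" by (auto simp: supp_def)
  ultimately show ?thesis
    by (auto simp: divisors_def intro: finite_subset)
qed

lemma supp_uminus: "supp (- D) = supp D"
  by (simp add: supp_def)

lemma divisors_uminus: "D \<in> divisors \<iota> \<Longrightarrow> - D \<in> divisors \<iota>"
  by (simp add: divisors_def supp_uminus)

lemma supp_zero: "supp 0 = {}"
  by (simp add: supp_def)

text \<open>The support of a sum can be smaller than the union of the supports. Summing over a
  finite set that contains the support puts \<open>D\<close>, \<open>E\<close> and
  \<open>D + E\<close> on one index set.\<close>

lemma div_degree_eq_sum:
  "finite S \<Longrightarrow> supp D \<subseteq> S \<Longrightarrow> div_degree \<iota> D = (\<Sum>P\<in>S. D P * int (residue_degree \<iota> P))"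
  unfolding div_degree_def by (rule sum.mono_neutral_left) (auto simp: supp_def)

lemma div_degree_add:
  assumes "D \<in> divisors \<iota>" "E \<in> divisors \<iota>"
  shows "div_degree \<iota> (D + E) = div_degree \<iota> D + div_degree \<iota> E"
proof -
  let ?S = "supp D \<union> supp E"
  have S: "finite ?S" using assms by (simp add: divisors_def)
  have "supp (D + E) \<subseteq> ?S" by (auto simp: supp_def)
  then show ?thesis
    using div_degree_eq_sum[OF S, of D \<iota>] div_degree_eq_sum[OF S, of E \<iota>]
      div_degree_eq_sum[OF S, of "D + E" \<iota>]
    by (simp add: distrib_right sum.distrib)
qed

lemma div_degree_uminus: "div_degree \<iota> (- D) = - div_degree \<iota> D"
  by (simp add: div_degree_def supp_uminus sum_negf)

lemma divisors0_zero: "0 \<in> divisors0 \<iota>"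
  by (simp add: divisors0_def divisors_def div_degree_def supp_zero)

lemma divisors0_diffI:
  assumes "D \<in> divisors \<iota>" "E \<in> divisors \<iota>" "div_degree \<iota> D = div_degree \<iota> E"
  shows "D - E \<in> divisors0 \<iota>"
  using assms divisors_add[OF assms(1) divisors_uminus[OF assms(2)]]
    div_degree_add[OF assms(1) divisors_uminus[OF assms(2)]]
  by (simp add: divisors0_def div_degree_uminus)

lemma divisor_closed_point: "D \<in> divisors \<iota> \<Longrightarrow> D P \<noteq> 0 \<Longrightarrow> P \<in> closed_points \<iota>"
  by (auto simp: divisors_def supp_def)

lemma disjoint_divisors_diff_left:
  "disjoint_divisors D F \<Longrightarrow> disjoint_divisors E F \<Longrightarrow> disjoint_divisors (D - E) F"
  by (force simp: disjoint_divisors_def supp_def disjoint_iff)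

lemma disjoint_divisors_diff_right:
  "disjoint_divisors F D \<Longrightarrow> disjoint_divisors F E \<Longrightarrow> disjoint_divisors F (D - E)"
  by (force simp: disjoint_divisors_def supp_def disjoint_iff)

lemma disjoint_divisors_add_right:
  "disjoint_divisors F D \<Longrightarrow> disjoint_divisors F E \<Longrightarrow> disjoint_divisors F (D + E)"
  by (force simp: disjoint_divisors_def supp_def disjoint_iff)

lemma disjoint_divisors_sym: "disjoint_divisors D E \<Longrightarrow> disjoint_divisors E D"
  by (auto simp: disjoint_divisors_def)

lemma principal_divisor_mult:
  "f \<noteq> 0 \<Longrightarrow> g \<noteq> 0 \<Longrightarrow>
    principal_divisor \<iota> (f * g) = principal_divisor \<iota> f + principal_divisor \<iota> g"
  by (auto simp: principal_divisor_def ord_at_mult)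

lemma principal_divisor_inverse:
  "f \<noteq> 0 \<Longrightarrow> principal_divisor \<iota> (inverse f) = - principal_divisor \<iota> f"
  by (auto simp: principal_divisor_def ord_at_inverse)

lemma principal_divisor_one: "principal_divisor \<iota> 1 = 0"
  by (auto simp: principal_divisor_def ord_at_one)

lemma pic_class_eq:
  assumes "D \<in> divisors \<iota>" "\<And>f. f \<noteq> 0 \<Longrightarrow> principal_divisor \<iota> f \<in> divisors \<iota>"
  shows "pic_class \<iota> D = {D + principal_divisor \<iota> f | f. f \<noteq> 0}"
  using assms by (auto simp: pic_class_def divisors_add)

section \<open>Line bundles\<close>

lemma line_bundleI:
  assumes "0 \<in> mero M"
    and "\<And>m n. m \<in> mero M \<Longrightarrow> n \<in> mero M \<Longrightarrow> m + n \<in> mero M"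
    and "\<And>c m. m \<in> mero M \<Longrightarrow> scal M c m \<in> mero M"
    and "\<And>m. m \<in> mero M \<Longrightarrow> scal M 1 m = m"
    and "\<And>c m n. m \<in> mero M \<Longrightarrow> n \<in> mero M \<Longrightarrow> scal M c (m + n) = scal M c m + scal M c n"
    and "\<And>c d m. m \<in> mero M \<Longrightarrow> scal M (c + d) m = scal M c m + scal M d m"
    and "\<And>c d m. m \<in> mero M \<Longrightarrow> scal M (c * d) m = scal M c (scal M d m)"
    and "\<exists>e\<in>mero M. e \<noteq> 0 \<and> mero M = range (\<lambda>c. scal M c e)"
    and "\<And>P. P \<in> closed_points \<iota> \<Longrightarrow> \<exists>e. generates_at M P e"
    and "\<exists>e\<in>mero M. finite {P \<in> closed_points \<iota>. \<not> generates_at M P e}"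
  shows "line_bundle \<iota> M"
  unfolding line_bundle_def using assms by (intro conjI ballI allI) assumption+

context
  fixes \<iota> :: "'k::field \<Rightarrow> 'f::field" and M :: "('f, 'm::ab_group_add) lbundle"
  assumes M: "line_bundle \<iota> M"
begin

lemma line_bundle_scal:
  assumes "m \<in> mero M"
  shows "scal M c m \<in> mero M" "scal M 1 m = m"
    "scal M (c * d) m = scal M c (scal M d m)" "scal M (c + d) m = scal M c m + scal M d m"
  using M assms by (simp_all add: line_bundle_def)

lemma line_bundle_scal_zero:
  assumes "m \<in> mero M"
  shows "scal M 0 m = 0" "scal M c 0 = 0"
proof -
  show *: "scal M 0 m = 0"
    using line_bundle_scal(4)[OF assms, of 0 0] by simp
  show "scal M c 0 = 0"
    using line_bundle_scal(3)[OF assms, of c 0] * by simp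
qed

lemma line_bundle_scal_eq_0_iff:
  assumes m: "m \<in> mero M"
  shows "scal M c m = 0 \<longleftrightarrow> c = 0 \<or> m = 0"
proof -
  have "m = 0" if "scal M c m = 0" "c \<noteq> 0"
    using line_bundle_scal(2)[OF m] line_bundle_scal(3)[OF m, of "inverse c" c] that
      line_bundle_scal_zero(2)[OF m] by simp
  then show ?thesis
    using line_bundle_scal_zero[OF m] by auto
qed

lemma line_bundle_scal_cancel:
  assumes m: "m \<in> mero M" "m \<noteq> 0" and eq: "scal M c m = scal M d m"
  shows "c = d"
proof -
  have "scal M (c - d) m = 0"
    using line_bundle_scal(4)[OF m(1), of "c - d" d] eq by simp
  then show ?thesis
    using line_bundle_scal_eq_0_iff[OF m(1)] m(2) by simp
qed

lemma line_bundle_span: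
  assumes m: "m \<in> mero M" and e: "e \<in> mero M" "e \<noteq> 0"
  shows "\<exists>h. m = scal M h e"
proof -
  obtain b where b: "b \<in> mero M" "mero M = range (\<lambda>c. scal M c b)"
    using M unfolding line_bundle_def by blast
  obtain a where a: "e = scal M a b" using b e by blast
  obtain c where c: "m = scal M c b" using b m by blast
  have "a \<noteq> 0" using a e line_bundle_scal_zero[OF b(1)] by auto
  then have "scal M (c * inverse a) e = m"
    using line_bundle_scal(3)[OF b(1), of "c * inverse a" a] a c by (simp add: mult.assoc)
  then show ?thesis by blast
qed

lemma section_ratio_scal:
  "t \<in> mero M \<Longrightarrow> t \<noteq> 0 \<Longrightarrow> section_ratio M (scal M h t) t = h"
  unfolding section_ratio_def by (rule the_equality) (auto dest: line_bundle_scal_cancel)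

section \<open>Local generators and divisors of meromorphic sections\<close>

lemma generates_at_ex: "P \<in> closed_points \<iota> \<Longrightarrow> \<exists>e. generates_at M P e"
  using M by (simp add: line_bundle_def)

text \<open>Each generator lies in the stalk spanned by the other; the two coefficients lie in
  \<open>P\<close> and multiply to 1 by cancellation.\<close>

lemma generates_at_unit:
  assumes P: "P \<in> closed_points \<iota>" and e: "generates_at M P e" and e': "generates_at M P e'"
  shows "\<exists>u. unit_at P u \<and> e' = scal M u e"
proof -
  have em: "e \<in> mero M" "e' \<in> mero M" "e \<noteq> 0" "e' \<noteq> 0"
    using e e' by (auto simp: generates_at_def)
  have "scal M 1 e' \<in> stalk M P"
    using e' closed_point_one[OF P] unfolding generates_at_def by blast
  then obtain c where c: "c \<in> P" "e' = scal M c e"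
    using e line_bundle_scal(2)[OF em(2)] by (auto simp: generates_at_def)
  have "scal M 1 e \<in> stalk M P"
    using e closed_point_one[OF P] unfolding generates_at_def by blast
  then obtain c' where c': "c' \<in> P" "e = scal M c' e'"
    using e' line_bundle_scal(2)[OF em(1)] by (auto simp: generates_at_def)
  have "scal M (c' * c) e = scal M 1 e"
    using c c' line_bundle_scal(3)[OF em(1), of c' c] line_bundle_scal(2)[OF em(1)] by simp
  then have "c' * c = 1"
    using line_bundle_scal_cancel em by blast
  then have "unit_at P c"
    using c c' inverse_unique[of c c'] by (auto simp: unit_at_def mult.commute)
  then show ?thesis using c by blast
qed

text \<open>Changing the local generator multiplies the coefficient by a unit, which has order 0, so
  the description in \<open>bundle_div\<close> has a single value.\<close>

lemma bundle_div_generator: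
  assumes P: "P \<in> closed_points \<iota>" and e: "generates_at M P e" and h: "h \<noteq> 0"
  shows "bundle_div \<iota> M (scal M h e) P = ord_at P h"
proof -
  have em: "e \<in> mero M" "e \<noteq> 0" using e by (auto simp: generates_at_def)
  have "(THE n. \<exists>e' h'. generates_at M P e' \<and> scal M h e = scal M h' e' \<and> n = ord_at P h')
    = ord_at P h"
  proof (rule the_equality)
    fix n
    assume "\<exists>e' h'. generates_at M P e' \<and> scal M h e = scal M h' e' \<and> n = ord_at P h'"
    then obtain e' h' where *: "generates_at M P e'" "scal M h e = scal M h' e'" "n = ord_at P h'"
      by blast
    obtain u where u: "unit_at P u" "e' = scal M u e"
      using generates_at_unit[OF P e *(1)] by blast
    have "h = h' * u"
      using * u line_bundle_scal(3)[OF em(1), of h' u] line_bundle_scal_cancel[OF em] by simp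
    moreover have "h' \<noteq> 0" "u \<noteq> 0" using calculation h by auto
    ultimately show "n = ord_at P h"
      using * u unit_at_iff_ord[OF P] by (simp add: ord_at_mult[OF P])
  qed (use e in blast)
  then show ?thesis using P by (simp add: bundle_div_def)
qed

lemma generates_at_decomp:
  assumes P: "P \<in> closed_points \<iota>" and m: "m \<in> mero M" "m \<noteq> 0"
  obtains e h where "generates_at M P e" "h \<noteq> 0" "m = scal M h e"
    "bundle_div \<iota> M m P = ord_at P h"
proof -
  obtain e where e: "generates_at M P e" using generates_at_ex[OF P] by blast
  then have em: "e \<in> mero M" "e \<noteq> 0" by (auto simp: generates_at_def)
  obtain h where h: "m = scal M h e" using line_bundle_span[OF m(1) em] by blast
  then have "h \<noteq> 0" using m line_bundle_scal_zero[OF em(1)] by auto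
  with e h show ?thesis using that bundle_div_generator[OF P e] by blast
qed

lemma bundle_div_scal:
  assumes m: "m \<in> mero M" "m \<noteq> 0" and c: "c \<noteq> 0"
  shows "bundle_div \<iota> M (scal M c m) = bundle_div \<iota> M m + principal_divisor \<iota> c"
proof
  fix P
  show "bundle_div \<iota> M (scal M c m) P = (bundle_div \<iota> M m + principal_divisor \<iota> c) P"
  proof (cases "P \<in> closed_points \<iota>")
    case P: True
    obtain e h where e: "generates_at M P e" and h: "h \<noteq> 0" "m = scal M h e"
      "bundle_div \<iota> M m P = ord_at P h"
      by (rule generates_at_decomp[OF P m])
    have "scal M c m = scal M (c * h) e"
      using e h by (simp add: line_bundle_scal(3) generates_at_def)
    then show ?thesis
      using bundle_div_generator[OF P e, of "c * h"] c h P
      by (simp add: ord_at_mult[OF P] principal_divisor_def)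
  qed (simp add: bundle_div_def principal_divisor_def)
qed

lemma bundle_class_eq:
  assumes m: "m \<in> mero M" "m \<noteq> 0"
  shows "bundle_class \<iota> M = {bundle_div \<iota> M m + principal_divisor \<iota> c | c. c \<noteq> 0}"
proof (intro equalityI subsetI)
  fix F assume "F \<in> bundle_class \<iota> M"
  then obtain n where n: "n \<in> mero M" "n \<noteq> 0" "F = bundle_div \<iota> M n"
    by (auto simp: bundle_class_def)
  obtain c where c: "n = scal M c m" using line_bundle_span n m by blast
  then have "c \<noteq> 0" using n line_bundle_scal_zero[OF m(1)] by auto
  then show "F \<in> {bundle_div \<iota> M m + principal_divisor \<iota> c | c. c \<noteq> 0}"
    using bundle_div_scal[OF m] c n by auto
next
  fix F assume "F \<in> {bundle_div \<iota> M m + principal_divisor \<iota> c | c. c \<noteq> 0}"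
  then obtain c where c: "c \<noteq> 0" "F = bundle_div \<iota> M m + principal_divisor \<iota> c" by blast
  then have "F = bundle_div \<iota> M (scal M c m)" "scal M c m \<in> mero M" "scal M c m \<noteq> 0"
    using m by (simp_all add: bundle_div_scal line_bundle_scal line_bundle_scal_eq_0_iff)
  then show "F \<in> bundle_class \<iota> M" unfolding bundle_class_def by blast
qed

lemma principal_divisor_mem_divisors0:
  assumes deg: "has_degree \<iota> M d" and f: "f \<noteq> 0"
  shows "principal_divisor \<iota> f \<in> divisors0 \<iota>"
proof -
  obtain m where m: "m \<in> mero M" "m \<noteq> 0"
    using M unfolding line_bundle_def by blast
  have fm: "scal M f m \<in> mero M" "scal M f m \<noteq> 0"
    using m f by (simp_all add: line_bundle_scal line_bundle_scal_eq_0_iff)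
  have "bundle_div \<iota> M (scal M f m) - bundle_div \<iota> M m \<in> divisors0 \<iota>"
    using deg m fm by (intro divisors0_diffI) (auto simp: has_degree_def)
  then show ?thesis using bundle_div_scal[OF m f] by simp
qed

end

subsection \<open>Divisor bundles and twists\<close>

text \<open>Multiplication by \<open>t powi n\<close> shifts orders by \<open>n\<close>, which
  reduces the condition to membership in \<open>P\<close>. The resulting generator of the fractional
  ideal serves both twists and divisor bundles.\<close>

lemma fractional_ideal_eq:
  assumes P: "P \<in> closed_points \<iota>" and t: "uniformizer_at P t"
  shows "{f. f = 0 \<or> 0 \<le> ord_at P f + n} = (\<lambda>c. c * t powi (- n)) ` P"
proof (intro equalityI subsetI)
  have t0: "t \<noteq> 0" using t by (simp add: uniformizer_at_def)
  fix f assume f: "f \<in> {f. f = 0 \<or> 0 \<le> ord_at P f + n}"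
  have "f * t powi n \<in> P"
  proof (cases "f = 0")
    case False
    then show ?thesis
      using f t0 by (simp add: mem_iff_ord_at_nonneg[OF P] ord_at_mult[OF P]
          ord_at_uniformizer_powi[OF P t])
  qed (simp add: closed_point_zero[OF P])
  moreover have "f = f * t powi n * t powi (- n)"
    using t0 by (simp add: power_int_minus)
  ultimately show "f \<in> (\<lambda>c. c * t powi (- n)) ` P" by blast
next
  have t0: "t \<noteq> 0" using t by (simp add: uniformizer_at_def)
  fix f assume "f \<in> (\<lambda>c. c * t powi (- n)) ` P"
  then obtain c where c: "c \<in> P" "f = c * t powi (- n)" by blast
  show "f \<in> {f. f = 0 \<or> 0 \<le> ord_at P f + n}"
  proof (cases "c = 0")
    case False
    then show ?thesis
      using c t0 mem_iff_ord_at_nonneg[OF P False]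
      by (simp add: ord_at_mult[OF P] ord_at_uniformizer_powi[OF P t])
  qed (use c in simp)
qed

text \<open>The stalk of a twist is a set of products, not of sums of products. It is a module
  because both factors, the stalk of \<open>M\<close> and the fractional ideal, have a single
  generator.\<close>

lemma generates_at_twist:
  assumes M: "line_bundle \<iota> M" and P: "P \<in> closed_points \<iota>" and t: "uniformizer_at P t"
    and e: "generates_at M P e"
  shows "generates_at (twist M D) P (scal M (t powi (- D P)) e)"
proof -
  have em: "e \<in> mero M" "e \<noteq> 0" using e by (auto simp: generates_at_def)
  have t0: "t \<noteq> 0" using t by (simp add: uniformizer_at_def)
  have scal: "scal M c (scal M d e) = scal M (c * d) e" for c d
    using line_bundle_scal(3)[OF M em(1)] by simp
  have st: "stalk M P = (\<lambda>c. scal M c e) ` P"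
    using e by (simp add: generates_at_def)
  have "stalk (twist M D) P = {scal M (f * c) e | f c. c \<in> P \<and> (f = 0 \<or> 0 \<le> ord_at P f + D P)}"
    unfolding scal[symmetric] by (simp add: twist_def st) blast
  also have "\<dots> = {scal M (f * c) e | f c. c \<in> P \<and> f \<in> (\<lambda>c. c * t powi (- D P)) ` P}"
    by (simp only: mem_Collect_eq flip: fractional_ideal_eq[OF P t])
  also have "\<dots> = (\<lambda>c. scal M c (scal M (t powi (- D P)) e)) ` P"
  proof (intro equalityI subsetI)
    fix x assume "x \<in> {scal M (f * c) e | f c. c \<in> P \<and> f \<in> (\<lambda>c. c * t powi (- D P)) ` P}"
    then obtain c d where "c \<in> P" "d \<in> P" "x = scal M (d * t powi (- D P) * c) e" by blast
    then have "d * c \<in> P" "x = scal M (d * c) (scal M (t powi (- D P)) e)"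
      by (simp_all add: scal closed_point_mult[OF P] mult_ac)
    then show "x \<in> (\<lambda>c. scal M c (scal M (t powi (- D P)) e)) ` P" by blast
  next
    fix x assume "x \<in> (\<lambda>c. scal M c (scal M (t powi (- D P)) e)) ` P"
    \<comment> \<open>The factor \<open>1\<close> is the coefficient of \<open>e\<close> in the
      untwisted stalk; the fractional ideal absorbs \<open>c\<close>.\<close>
    then obtain c where "c \<in> P" "x = scal M (c * t powi (- D P) * 1) e"
      by (auto simp: scal)
    then show "x \<in> {scal M (f * c) e | f c. c \<in> P \<and> f \<in> (\<lambda>c. c * t powi (- D P)) ` P}"
      using closed_point_one[OF P] by blast
  qed
  finally show ?thesis
    using em t0 by (simp add: generates_at_def twist_def line_bundle_scal[OF M]
        line_bundle_scal_eq_0_iff[OF M])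
qed

lemma line_bundle_twist:
  assumes M: "line_bundle \<iota> M" and D: "D \<in> divisors \<iota>"
  shows "line_bundle \<iota> (twist M D)"
proof -
  have [simp]: "mero (twist M D) = mero M" "scal (twist M D) = scal M"
    by (simp_all add: twist_def)
  have gen: "\<exists>e. generates_at (twist M D) P e" if P: "P \<in> closed_points \<iota>" for P
    using generates_at_twist[OF M P] generates_at_ex[OF M P] uniformizer_ex[OF P] by blast
  obtain e where e: "e \<in> mero M" "finite {P \<in> closed_points \<iota>. \<not> generates_at M P e}"
    using M unfolding line_bundle_def by blast
  \<comment> \<open>Outside the support of \<open>D\<close> the twisting power of \<open>t\<close>
    has exponent 0, so only finitely many points are lost.\<close>
  have "generates_at (twist M D) P e"
    if P: "P \<in> closed_points \<iota>" and "generates_at M P e" "P \<notin> supp D" for P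
  proof -
    obtain t where t: "uniformizer_at P t" using uniformizer_ex[OF P] by blast
    show ?thesis
      using generates_at_twist[OF M P t that(2), of D] that(3) e line_bundle_scal[OF M]
      by (simp add: supp_def)
  qed
  then have "{P \<in> closed_points \<iota>. \<not> generates_at (twist M D) P e}
    \<subseteq> {P \<in> closed_points \<iota>. \<not> generates_at M P e} \<union> supp D" by blast
  moreover have "finite ({P \<in> closed_points \<iota>. \<not> generates_at M P e} \<union> supp D)"
    using e D by (simp add: divisors_def)
  ultimately have "finite {P \<in> closed_points \<iota>. \<not> generates_at (twist M D) P e}"
    by (rule finite_subset)
  then have fin: "\<exists>e\<in>mero M. finite {P \<in> closed_points \<iota>. \<not> generates_at (twist M D) P e}"
    using e(1) by blast
  have span: "\<exists>e\<in>mero M. e \<noteq> 0 \<and> mero M = range (\<lambda>c. scal M c e)"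
    using M unfolding line_bundle_def by blast
  show ?thesis
    by (rule line_bundleI) (use M gen fin span in \<open>simp_all add: line_bundle_def\<close>)
qed

text \<open>Passing to the generator \<open>t powi (- D P)\<close> times \<open>e\<close> turns the
  coefficient \<open>h\<close> into \<open>h * t powi (D P)\<close>, which shifts the order by
  \<open>D P\<close>.\<close>

lemma bundle_div_twist:
  assumes M: "line_bundle \<iota> M" and D: "D \<in> divisors \<iota>" and m: "m \<in> mero M" "m \<noteq> 0"
  shows "bundle_div \<iota> (twist M D) m = bundle_div \<iota> M m + D"
proof
  fix P
  show "bundle_div \<iota> (twist M D) m P = (bundle_div \<iota> M m + D) P"
  proof (cases "P \<in> closed_points \<iota>")
    case P: True
    obtain e h where e: "generates_at M P e" and h: "h \<noteq> 0" "m = scal M h e"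
      "bundle_div \<iota> M m P = ord_at P h"
      by (rule generates_at_decomp[OF M P m])
    obtain t where t: "uniformizer_at P t" using uniformizer_ex[OF P] by blast
    then have t0: "t \<noteq> 0" by (simp add: uniformizer_at_def)
    have cancel: "h * t powi (D P) * t powi (- D P) = h"
      using t0 by (simp add: power_int_minus)
    have "m = scal M (h * t powi (D P)) (scal M (t powi (- D P)) e)"
      using h(2) e line_bundle_scal(3)[OF M, of e "h * t powi (D P)" "t powi (- D P)"]
      unfolding cancel generates_at_def by simp
    then have "bundle_div \<iota> (twist M D) m P = ord_at P (h * t powi (D P))"
      using bundle_div_generator[OF line_bundle_twist[OF M D] P generates_at_twist[OF M P t e],
          of "h * t powi (D P)"] h t0 by (simp add: twist_def)
    then show ?thesis
      using h t0 by (simp add: ord_at_mult[OF P] ord_at_uniformizer_powi[OF P t])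
  next
    case False
    then show ?thesis
      using divisor_closed_point[OF D] by (auto simp: bundle_div_def)
  qed
qed

lemma generates_at_divisor_bundle:
  assumes P: "P \<in> closed_points \<iota>" and t: "uniformizer_at P t"
  shows "generates_at (divisor_bundle E) P (t powi (- E P))"
proof -
  have "t \<noteq> 0" using t by (simp add: uniformizer_at_def)
  then show ?thesis
    using fractional_ideal_eq[OF P t, of "E P"] by (simp add: generates_at_def divisor_bundle_def)
qed

lemma generates_at_divisor_bundle_one:
  assumes P: "P \<in> closed_points \<iota>" and "E P = 0"
  shows "generates_at (divisor_bundle E) P 1"
  using generates_at_divisor_bundle[OF P, of _ E] assms(2) uniformizer_ex[OF P] by auto

lemma line_bundle_divisor_bundle:
  assumes E: "E \<in> divisors \<iota>"
  shows "line_bundle \<iota> (divisor_bundle E)"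
proof -
  have [simp]: "mero (divisor_bundle E) = UNIV" "scal (divisor_bundle E) = (*)"
    by (simp_all add: divisor_bundle_def)
  have "{P \<in> closed_points \<iota>. \<not> generates_at (divisor_bundle E) P 1} \<subseteq> supp E"
    using generates_at_divisor_bundle_one by (auto simp: supp_def)
  then have "\<exists>e. finite {P \<in> closed_points \<iota>. \<not> generates_at (divisor_bundle E) P e}"
    using E by (auto simp: divisors_def intro: finite_subset)
  moreover have "UNIV = range (\<lambda>c :: 'b. c * 1)" by simp
  moreover have "\<exists>e. generates_at (divisor_bundle E) P e" if "P \<in> closed_points \<iota>" for P
    using generates_at_divisor_bundle[OF that] uniformizer_ex[OF that] by blast
  ultimately show ?thesis
    by (intro line_bundleI) (simp_all add: algebra_simps exI[of _ 1])
qed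

text \<open>The section \<open>1\<close> is \<open>t powi (E P)\<close> times the local generator.
  Hence in the second kind of identification, applied to the section \<open>1\<close>, the function
  is evaluated at \<open>E\<close> itself.\<close>

lemma bundle_div_divisor_bundle_one:
  assumes E: "E \<in> divisors \<iota>"
  shows "bundle_div \<iota> (divisor_bundle E) 1 = E"
proof
  fix P
  show "bundle_div \<iota> (divisor_bundle E) 1 P = E P"
  proof (cases "P \<in> closed_points \<iota>")
    case P: True
    obtain t where t: "uniformizer_at P t" using uniformizer_ex[OF P] by blast
    then have t0: "t \<noteq> 0" by (simp add: uniformizer_at_def)
    then have "scal (divisor_bundle E) (t powi (E P)) (t powi (- E P)) = 1"
      by (simp add: divisor_bundle_def power_int_minus)
    then show ?thesis
      using bundle_div_generator[OF line_bundle_divisor_bundle[OF E] P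
          generates_at_divisor_bundle[OF P t, of E], of "t powi (E P)"] t0
      by (simp add: ord_at_uniformizer_powi[OF P t])
  next
    case False
    then show ?thesis
      using divisor_closed_point[OF E] by (auto simp: bundle_div_def)
  qed
qed

subsection \<open>Dual bundles\<close>

text \<open>The linear form dual to \<open>e\<close>, sending \<open>scal M c e\<close> to
  \<open>c\<close>. Elements of the dual bundle are total functions required to vanish outside
  \<open>mero M\<close>, hence the default 0.\<close>

definition dual_section ::
  "('f::field, 'm::ab_group_add) lbundle \<Rightarrow> 'm \<Rightarrow> 'm \<Rightarrow> 'f" where
  "dual_section M e m = (if m \<in> mero M then section_ratio M m e else 0)"

lemma scal_dual_bundle: "scal (dual_bundle M) c \<phi> = (\<lambda>m. c * \<phi> m)"
  by (simp add: dual_bundle_def Let_def)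

lemma mem_mero_dual_bundle:
  "\<phi> \<in> mero (dual_bundle M) \<longleftrightarrow>
    (\<forall>m\<in>mero M. \<forall>n\<in>mero M. \<phi> (m + n) = \<phi> m + \<phi> n) \<and>
    (\<forall>c. \<forall>m\<in>mero M. \<phi> (scal M c m) = c * \<phi> m) \<and> (\<forall>m. m \<notin> mero M \<longrightarrow> \<phi> m = 0)"
  by (simp add: dual_bundle_def Let_def)

lemma stalk_dual_bundle:
  "stalk (dual_bundle M) P = {\<phi> \<in> mero (dual_bundle M). \<forall>m\<in>stalk M P. \<phi> m \<in> P}"
  by (simp add: dual_bundle_def Let_def)

context
  fixes \<iota> :: "'k::field \<Rightarrow> 'f::field" and M :: "('f, 'm::ab_group_add) lbundle"
  assumes M: "line_bundle \<iota> M"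
begin

lemma dual_section_scal:
  assumes "e \<in> mero M" "e \<noteq> 0"
  shows "dual_section M e (scal M c e) = c"
  using assms by (simp add: dual_section_def section_ratio_scal[OF M] line_bundle_scal[OF M])

lemma dual_section_self: "e \<in> mero M \<Longrightarrow> e \<noteq> 0 \<Longrightarrow> dual_section M e e = 1"
  using dual_section_scal[of e 1] line_bundle_scal[OF M] by simp

lemma dual_section_mem:
  assumes e: "e \<in> mero M" "e \<noteq> 0"
  shows "dual_section M e \<in> mero (dual_bundle M)"
proof -
  have "dual_section M e (m + n) = dual_section M e m + dual_section M e n"
    if mn: "m \<in> mero M" "n \<in> mero M" for m n
  proof -
    obtain a b where ab: "m = scal M a e" "n = scal M b e"
      using mn line_bundle_span[OF M _ e] by meson
    then have "m + n = scal M (a + b) e" by (simp add: line_bundle_scal[OF M e(1)])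
    then show ?thesis by (simp add: ab dual_section_scal[OF e])
  qed
  moreover have "dual_section M e (scal M c m) = c * dual_section M e m" if m: "m \<in> mero M" for c m
  proof -
    obtain a where a: "m = scal M a e" using m line_bundle_span[OF M _ e] by meson
    then have "scal M c m = scal M (c * a) e" by (simp add: line_bundle_scal[OF M e(1)])
    then show ?thesis by (simp add: a dual_section_scal[OF e])
  qed
  ultimately show ?thesis
    by (simp add: mem_mero_dual_bundle) (simp add: dual_section_def)
qed

lemma dual_eq_scal_dual_section:
  assumes \<phi>: "\<phi> \<in> mero (dual_bundle M)" and e: "e \<in> mero M" "e \<noteq> 0"
  shows "\<phi> = scal (dual_bundle M) (\<phi> e) (dual_section M e)"
proof
  fix m
  show "\<phi> m = scal (dual_bundle M) (\<phi> e) (dual_section M e) m"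
  proof (cases "m \<in> mero M")
    case True
    then obtain a where "m = scal M a e" using line_bundle_span[OF M _ e] by meson
    then show ?thesis
      using \<phi> e by (simp add: mem_mero_dual_bundle scal_dual_bundle dual_section_scal)
  next
    case False
    then show ?thesis
      using \<phi> by (simp add: mem_mero_dual_bundle scal_dual_bundle dual_section_def)
  qed
qed

lemma mero_dual_scal:
  "\<phi> \<in> mero (dual_bundle M) \<Longrightarrow> scal (dual_bundle M) c \<phi> \<in> mero (dual_bundle M)"
  by (simp add: mem_mero_dual_bundle scal_dual_bundle distrib_left mult_ac)

lemma generates_at_dual:
  assumes P: "P \<in> closed_points \<iota>" and e: "generates_at M P e"
  shows "generates_at (dual_bundle M) P (dual_section M e)"
proof -
  have em: "e \<in> mero M" "e \<noteq> 0" and st: "stalk M P = (\<lambda>c. scal M c e) ` P"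
    using e by (auto simp: generates_at_def)
  have e_stalk: "e \<in> stalk M P"
    using st closed_point_one[OF P] line_bundle_scal(2)[OF M em(1)] by (metis image_eqI)
  have "dual_section M e \<noteq> 0"
    using dual_section_self[OF em] by auto
  moreover have "stalk (dual_bundle M) P = (\<lambda>c. scal (dual_bundle M) c (dual_section M e)) ` P"
  proof (intro equalityI subsetI)
    fix \<phi> assume "\<phi> \<in> stalk (dual_bundle M) P"
    then have "\<phi> e \<in> P" "\<phi> = scal (dual_bundle M) (\<phi> e) (dual_section M e)"
      using e_stalk dual_eq_scal_dual_section[OF _ em] by (auto simp: stalk_dual_bundle)
    then show "\<phi> \<in> (\<lambda>c. scal (dual_bundle M) c (dual_section M e)) ` P" by blast
  next
    fix \<phi> assume "\<phi> \<in> (\<lambda>c. scal (dual_bundle M) c (dual_section M e)) ` P"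
    then obtain c where c: "c \<in> P" "\<phi> = scal (dual_bundle M) c (dual_section M e)" by blast
    then show "\<phi> \<in> stalk (dual_bundle M) P"
      by (auto simp: stalk_dual_bundle mero_dual_scal dual_section_mem[OF em] st)
        (simp add: scal_dual_bundle dual_section_scal[OF em] closed_point_mult[OF P])
  qed
  ultimately show ?thesis
    using dual_section_mem[OF em] by (simp add: generates_at_def)
qed

lemma line_bundle_dual: "line_bundle \<iota> (dual_bundle M)"
proof -
  have sc: "scal (dual_bundle M) = (\<lambda>c \<phi> m. c * \<phi> m)"
    by (intro ext) (simp add: scal_dual_bundle)
  obtain e where e: "e \<in> mero M" "e \<noteq> 0"
    using M unfolding line_bundle_def by blast
  have "dual_section M e \<noteq> 0" using dual_section_self[OF e] by auto
  moreover have "mero (dual_bundle M) = range (\<lambda>c. scal (dual_bundle M) c (dual_section M e))"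
    using dual_eq_scal_dual_section[OF _ e] mero_dual_scal dual_section_mem[OF e] by fast
  ultimately have span: "\<exists>\<psi>\<in>mero (dual_bundle M). \<psi> \<noteq> 0 \<and>
      mero (dual_bundle M) = range (\<lambda>c. scal (dual_bundle M) c \<psi>)"
    using dual_section_mem[OF e] by blast
  obtain b where b: "b \<in> mero M" "finite {P \<in> closed_points \<iota>. \<not> generates_at M P b}"
    using M unfolding line_bundle_def by blast
  have fin: "\<exists>\<psi>\<in>mero (dual_bundle M). finite {P \<in> closed_points \<iota>. \<not> generates_at (dual_bundle M) P \<psi>}"
  \<comment> \<open>The finiteness clause for \<open>M\<close> admits the zero section, which
    generates no stalk. In that case the closed points are finite in number and any form
    serves.\<close>
  proof (cases "b = 0")
    case True
    then have "{P \<in> closed_points \<iota>. \<not> generates_at M P b} = closed_points \<iota>"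
      by (auto simp: generates_at_def)
    then have "finite (closed_points \<iota>)" using b by simp
    then show ?thesis using dual_section_mem[OF e] by auto
  next
    case False
    have "{P \<in> closed_points \<iota>. \<not> generates_at (dual_bundle M) P (dual_section M b)}
      \<subseteq> {P \<in> closed_points \<iota>. \<not> generates_at M P b}"
      using generates_at_dual by blast
    then show ?thesis
      using b dual_section_mem[OF b(1) False] by (blast intro: finite_subset)
  qed
  have gen: "\<exists>\<psi>. generates_at (dual_bundle M) P \<psi>" if "P \<in> closed_points \<iota>" for P
    using generates_at_dual[OF that] generates_at_ex[OF M that] by blast
  show ?thesis
    by (rule line_bundleI)
      (use span fin gen mero_dual_scal in \<open>simp_all add: sc mem_mero_dual_bundle plus_fun_def
        zero_fun_def fun_eq_iff algebra_simps\<close>)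
qed

text \<open>If \<open>m\<close> is \<open>h\<close> times a local generator \<open>e\<close>, its
  dual form is \<open>inverse h\<close> times the dual form of \<open>e\<close>, so the order
  changes sign.\<close>

lemma bundle_div_dual_section:
  assumes m: "m \<in> mero M" "m \<noteq> 0"
  shows "bundle_div \<iota> (dual_bundle M) (dual_section M m) = - bundle_div \<iota> M m"
proof
  fix P
  show "bundle_div \<iota> (dual_bundle M) (dual_section M m) P = (- bundle_div \<iota> M m) P"
  proof (cases "P \<in> closed_points \<iota>")
    case P: True
    obtain e h where e: "generates_at M P e" and h: "h \<noteq> 0" "m = scal M h e"
      "bundle_div \<iota> M m P = ord_at P h"
      by (rule generates_at_decomp[OF M P m])
    have em: "e \<in> mero M" "e \<noteq> 0" using e by (auto simp: generates_at_def)
    have "e = scal M (inverse h) m"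
      using h line_bundle_scal(2,3)[OF M em(1)] by (metis left_inverse)
    then have "dual_section M m e = inverse h"
      using dual_section_scal[OF m, of "inverse h"] by simp
    then have "dual_section M m = scal (dual_bundle M) (inverse h) (dual_section M e)"
      using dual_eq_scal_dual_section[OF dual_section_mem[OF m] em] by simp
    then show ?thesis
      using bundle_div_generator[OF line_bundle_dual P generates_at_dual[OF P e], of "inverse h"] h
      by (simp add: ord_at_inverse[OF P])
  qed (simp add: bundle_div_def)
qed

text \<open>The form dual to \<open>m\<close> serves as the meromorphic section that represents the
  class. The choice of \<open>m\<close> is free: \<open>d0\<close> leads to divisors such as
  \<open>D - D0\<close>, and \<open>e0\<close> to \<open>E - E0\<close>.\<close>

lemma bundle_class_twist_dual:
  assumes m: "m \<in> mero M" "m \<noteq> 0" and D: "D \<in> divisors \<iota>"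
  shows "bundle_class \<iota> (twist (dual_bundle M) D)
    = {D - bundle_div \<iota> M m + principal_divisor \<iota> c | c. c \<noteq> 0}"
proof -
  have \<phi>: "dual_section M m \<in> mero (dual_bundle M)" "dual_section M m \<noteq> 0"
    using dual_section_mem[OF m] dual_section_self[OF m] by auto
  have "bundle_div \<iota> (twist (dual_bundle M) D) (dual_section M m) = D - bundle_div \<iota> M m"
    by (simp add: bundle_div_twist[OF line_bundle_dual D \<phi>] bundle_div_dual_section[OF m])
  then show ?thesis
    using bundle_class_eq[OF line_bundle_twist[OF line_bundle_dual D], of "dual_section M m"] \<phi>
    by (simp add: twist_def)
qed

end

subsection \<open>Tensor products\<close>

text \<open>Nonvanishing of \<open>\<mu>\<close> is given on local generators, so a closed point is
  used even for the global claim \<open>\<mu> m n \<noteq> 0\<close>. Bilinearity pulls out the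
  product of the two coefficients.\<close>

lemma tensor_product_nonzero:
  assumes T: "tensor_product \<iota> M N T \<mu>" and M: "line_bundle \<iota> M" and N: "line_bundle \<iota> N"
    and m: "m \<in> mero M" "m \<noteq> 0" and n: "n \<in> mero N" "n \<noteq> 0" and P: "P \<in> closed_points \<iota>"
  shows "\<mu> m n \<noteq> 0" "bundle_div \<iota> T (\<mu> m n) P = bundle_div \<iota> M m P + bundle_div \<iota> N n P"
proof -
  have T': "line_bundle \<iota> T" using T by (simp add: tensor_product_def)
  obtain e h where e: "generates_at M P e" and h: "h \<noteq> 0" "m = scal M h e"
    "bundle_div \<iota> M m P = ord_at P h"
    by (rule generates_at_decomp[OF M P m])
  obtain e' h' where e': "generates_at N P e'" and h': "h' \<noteq> 0" "n = scal N h' e'"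
    "bundle_div \<iota> N n P = ord_at P h'"
    by (rule generates_at_decomp[OF N P n])
  have em: "e \<in> mero M" "e' \<in> mero N" using e e' by (auto simp: generates_at_def)
  have g: "generates_at T P (\<mu> e e')" using T e e' P by (simp add: tensor_product_def)
  then have gm: "\<mu> e e' \<in> mero T" "\<mu> e e' \<noteq> 0" by (auto simp: generates_at_def)
  have "\<mu> m n = scal T h (\<mu> e n)"
    using T em n h by (simp add: tensor_product_def)
  also have "\<mu> e n = scal T h' (\<mu> e e')"
    using T em h' by (simp add: tensor_product_def)
  finally have eq: "\<mu> m n = scal T (h * h') (\<mu> e e')"
    using line_bundle_scal(3)[OF T' gm(1)] by simp
  then show "\<mu> m n \<noteq> 0"
    using line_bundle_scal_eq_0_iff[OF T' gm(1)] gm h h' by simp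
  show "bundle_div \<iota> T (\<mu> m n) P = bundle_div \<iota> M m P + bundle_div \<iota> N n P"
    using bundle_div_generator[OF T' P g, of "h * h'"] eq h h' by (simp add: ord_at_mult[OF P])
qed

lemma bundle_div_tensor_product:
  assumes "tensor_product \<iota> M N T \<mu>" "line_bundle \<iota> M" "line_bundle \<iota> N"
    "m \<in> mero M" "m \<noteq> 0" "n \<in> mero N" "n \<noteq> 0"
  shows "bundle_div \<iota> T (\<mu> m n) = bundle_div \<iota> M m + bundle_div \<iota> N n"
proof
  fix P
  show "bundle_div \<iota> T (\<mu> m n) P = (bundle_div \<iota> M m + bundle_div \<iota> N n) P"
    using tensor_product_nonzero(2)[OF assms, of P]
    by (cases "P \<in> closed_points \<iota>") (auto simp: bundle_div_def)
qed

section \<open>Values of functions at divisors\<close>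

lemma prod_powi_supp:
  assumes "finite S" "supp F \<subseteq> S"
  shows "(\<Prod>P\<in>supp F. x P powi F P) = (\<Prod>P\<in>S. x P powi F P)"
  by (rule prod.mono_neutral_left) (use assms in \<open>auto simp: supp_def\<close>)

text \<open>Exponents of \<open>F\<close> and \<open>G\<close> may cancel, so the product is taken
  over the union of the supports; the exponent law at such points relies on \<open>x\<close> being
  nonzero there.\<close>

lemma prod_powi_add:
  fixes x :: "'f point \<Rightarrow> 'k::field"
  assumes fin: "finite (supp F)" "finite (supp G)"
    and x: "\<And>P. P \<in> supp F \<union> supp G \<Longrightarrow> x P \<noteq> 0"
  shows "(\<Prod>P\<in>supp (F + G). x P powi (F + G) P)
    = (\<Prod>P\<in>supp F. x P powi F P) * (\<Prod>P\<in>supp G. x P powi G P)"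
proof -
  let ?S = "supp F \<union> supp G"
  have S: "finite ?S" using fin by simp
  have "supp (F + G) \<subseteq> ?S" by (auto simp: supp_def)
  then have "(\<Prod>P\<in>supp (F + G). x P powi (F + G) P) = (\<Prod>P\<in>?S. x P powi (F + G) P)"
    by (rule prod_powi_supp[OF S])
  also have "\<dots> = (\<Prod>P\<in>?S. x P powi F P * x P powi G P)"
    using x by (intro prod.cong) (auto simp: power_int_add)
  also have "\<dots> = (\<Prod>P\<in>?S. x P powi F P) * (\<Prod>P\<in>?S. x P powi G P)"
    by (rule prod.distrib)
  also have "\<dots> = (\<Prod>P\<in>supp F. x P powi F P) * (\<Prod>P\<in>supp G. x P powi G P)"
    by (simp add: prod_powi_supp[OF S])
  finally show ?thesis .
qed

context
  fixes \<iota> :: "'k::field \<Rightarrow> 'f::field" and F :: "'f divisor" and f :: 'f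
  assumes hom: "field_hom \<iota>" and F: "F \<in> divisors \<iota>"
    and unit: "\<And>P. P \<in> supp F \<Longrightarrow> unit_at P f"
begin

private lemma closed_supp: "P \<in> supp F \<Longrightarrow> P \<in> closed_points \<iota>"
  using F by (auto simp: divisors_def)

lemma value_at_nonzero: "value_at \<iota> f F \<noteq> 0"
  using F residue_norm_inverse(1)[OF closed_supp hom unit]
  by (simp add: value_at_def divisors_def)

lemma value_at_inverse: "value_at \<iota> (inverse f) F = inverse (value_at \<iota> f F)"
proof -
  have "value_at \<iota> (inverse f) F = (\<Prod>P\<in>supp F. inverse (residue_norm \<iota> P f powi F P))"
    unfolding value_at_def
    using residue_norm_inverse(2)[OF closed_supp hom unit]
    by (intro prod.cong) (simp_all add: power_int_inverse)
  then show ?thesis by (simp add: value_at_def prod_inversef[unfolded comp_def])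
qed

end

lemma value_at_uminus: "value_at \<iota> f (- F) = inverse (value_at \<iota> f F)"
  by (simp add: value_at_def supp_uminus power_int_minus prod_inversef[symmetric])

lemma value_at_diff:
  assumes hom: "field_hom \<iota>" and F: "F \<in> divisors \<iota>" and G: "G \<in> divisors \<iota>"
    and unit: "\<And>P. P \<in> supp F \<union> supp G \<Longrightarrow> unit_at P f"
  shows "value_at \<iota> f (F - G) = value_at \<iota> f F / value_at \<iota> f G"
proof -
  have "residue_norm \<iota> P f \<noteq> 0" if "P \<in> supp F \<union> supp G" for P
    using residue_norm_inverse(1)[OF _ hom unit[OF that]] that F G by (auto simp: divisors_def)
  then have "value_at \<iota> f (F + - G) = value_at \<iota> f F * value_at \<iota> f (- G)"
    unfolding value_at_def using F G
    by (intro prod_powi_add) (simp_all add: divisors_def supp_uminus)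
  then show ?thesis by (simp add: value_at_uminus divide_inverse)
qed

section \<open>Norms of line bundles\<close>

lemma supp_add_subset: "supp (F + G) \<subseteq> supp F \<union> supp G"
  by (auto simp: supp_def)

lemma norm_classI:
  assumes "(c', \<phi>') \<in> norm_reps M F"
    and "\<And>P. P \<in> supp F \<Longrightarrow> unit_at P (u P)"
    and "\<And>P. P \<in> supp F \<Longrightarrow> \<phi> P = scal M (u P) ` \<phi>' P"
    and "c' = c * (\<Prod>P\<in>supp F. residue_norm \<iota> P (u P) powi F P)"
  shows "(c', \<phi>') \<in> norm_class \<iota> M F (c, \<phi>)"
  unfolding norm_class_def using assms by blast

lemma norm_class_subset_reps: "norm_class \<iota> M F x \<subseteq> norm_reps M F"
  by (auto simp: norm_class_def)

lemma norm_reps_add: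
  assumes "(c, \<phi>) \<in> norm_reps M F" "(c', \<phi>) \<in> norm_reps M G"
  shows "(d, \<phi>) \<in> norm_reps M (F + G)"
proof -
  have "\<exists>m. generates_at M P m \<and> \<phi> P = fibre_elt M P m" if "P \<in> supp (F + G)" for P
    using assms subsetD[OF supp_add_subset that] by (auto simp: norm_reps_def)
  then show ?thesis by (simp add: norm_reps_def)
qed

lemma norm_reps_fibre:
  "(c, \<phi>) \<in> norm_reps M F \<Longrightarrow> P \<in> supp F \<Longrightarrow> \<exists>m. generates_at M P m \<and> \<phi> P = fibre_elt M P m"
  by (simp add: norm_reps_def)

context
  fixes \<iota> :: "'k::field \<Rightarrow> 'f::field" and M :: "('f, 'm::ab_group_add) lbundle"
  assumes hom: "field_hom \<iota>" and M: "line_bundle \<iota> M"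
begin

text \<open>The module laws for \<open>scal\<close> are available only on \<open>mero M\<close>;
  cosets have to lie there before scalars acting on them can be multiplied or cancelled.\<close>

lemma fibre_elt_subset_mero: "generates_at M P m \<Longrightarrow> fibre_elt M P m \<subseteq> mero M"
  using M by (auto simp: fibre_elt_def generates_at_def line_bundle_def)

lemma norm_reps_subset_mero:
  assumes "(c, \<phi>) \<in> norm_reps M F" "P \<in> supp F"
  shows "\<phi> P \<subseteq> mero M"
  using norm_reps_fibre[OF assms] fibre_elt_subset_mero by force

lemma scal_image_one: "S \<subseteq> mero M \<Longrightarrow> scal M 1 ` S = S"
  using line_bundle_scal(2)[OF M] by force

lemma scal_image_mult: "S \<subseteq> mero M \<Longrightarrow> scal M c ` scal M d ` S = scal M (c * d) ` S"
  using line_bundle_scal(3)[OF M, of _ c d] by (force simp: image_image)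

text \<open>Scalars acting on a coset are determined only modulo the maximal ideal. Applying the
  equality of cosets to \<open>m\<close> itself shows that \<open>u - v\<close> lies in that ideal,
  and residue norms see only residues.\<close>

lemma scal_image_fibre_cong:
  assumes P: "P \<in> closed_points \<iota>" and m: "generates_at M P m"
    and u: "unit_at P u" and v: "unit_at P v"
    and eq: "scal M u ` fibre_elt M P m = scal M v ` fibre_elt M P m"
  shows "residue_norm \<iota> P u = residue_norm \<iota> P v"
proof (rule residue_norm_cong[OF P hom])
  show uv: "u \<in> P" "v \<in> P" using u v by (auto simp: unit_at_def)
  have mm: "m \<in> mero M" "m \<noteq> 0" using m by (auto simp: generates_at_def)
  have "scal M 1 m \<in> stalk M P"
    using m closed_point_one[OF P] unfolding generates_at_def by blast
  then have "m + scal M 0 (scal M 1 m) \<in> fibre_elt M P m"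
    using max_ideal_zero[OF P] unfolding fibre_elt_def by blast
  then have "m \<in> fibre_elt M P m"
    using line_bundle_scal_zero(1)[OF M line_bundle_scal(1)[OF M mm(1)]] by simp
  then have "scal M u m \<in> scal M v ` fibre_elt M P m"
    using eq by blast
  then obtain c n where "c \<in> max_ideal P" "n \<in> stalk M P"
    "scal M u m = scal M v (m + scal M c n)"
    by (auto simp: fibre_elt_def)
  moreover from this obtain d where "d \<in> P" "n = scal M d m"
    using m by (auto simp: generates_at_def)
  ultimately have c: "c \<in> max_ideal P" "d \<in> P"
    and "scal M u m = scal M v (m + scal M c (scal M d m))"
    by simp_all
  note this(3)
  also have "m + scal M c (scal M d m) = scal M (1 + c * d) m"
    by (simp add: line_bundle_scal[OF M mm(1)])
  also have "scal M v \<dots> = scal M (v * (1 + c * d)) m"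
    by (simp add: line_bundle_scal(3)[OF M mm(1)])
  finally have "u = v * (1 + c * d)"
    by (rule line_bundle_scal_cancel[OF M mm])
  then have "u - v = (v * d) * c" by (simp add: algebra_simps)
  then show "u - v \<in> max_ideal P"
    using max_ideal_mult[OF P c(1) closed_point_mult[OF P uv(2) c(2)]] by simp
qed

section \<open>Equivalence of representatives and products of norm elements\<close>

lemma norm_class_self:
  assumes F: "F \<in> divisors \<iota>" and x: "x \<in> norm_reps M F"
  shows "x \<in> norm_class \<iota> M F x"
proof -
  obtain c \<phi> where c: "x = (c, \<phi>)" by (cases x)
  have "\<phi> P = scal M 1 ` \<phi> P \<and> unit_at P 1 \<and> residue_norm \<iota> P 1 = 1" if "P \<in> supp F" for P
  proof -
    have P: "P \<in> closed_points \<iota>" using F that by (auto simp: divisors_def)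
    have "\<phi> P \<subseteq> mero M" using norm_reps_subset_mero x that by (simp add: c)
    then show ?thesis
      by (simp add: scal_image_one unit_at_one[OF P] residue_norm_one[OF P hom])
  qed
  then show ?thesis
    using x by (auto simp: c norm_class_def intro!: exI[of _ "\<lambda>_. 1"])
qed

lemma norm_class_sym:
  assumes F: "F \<in> divisors \<iota>" and x: "x \<in> norm_reps M F" and y: "y \<in> norm_class \<iota> M F x"
  shows "x \<in> norm_class \<iota> M F y"
proof -
  obtain c \<phi> d \<psi> where xy: "x = (c, \<phi>)" "y = (d, \<psi>)" by (cases x, cases y)
  obtain u where u: "\<And>P. P \<in> supp F \<Longrightarrow> unit_at P (u P) \<and> \<phi> P = scal M (u P) ` \<psi> P"
    and d: "d = c * (\<Prod>P\<in>supp F. residue_norm \<iota> P (u P) powi F P)"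
    using y by (auto simp: xy norm_class_def)
  have P: "P \<in> closed_points \<iota>" if "P \<in> supp F" for P
    using F that by (auto simp: divisors_def)
  have "\<psi> P = scal M (inverse (u P)) ` \<phi> P" if "P \<in> supp F" for P
  proof -
    have "\<psi> P \<subseteq> mero M"
      using norm_reps_subset_mero norm_class_subset_reps y that unfolding xy by blast
    then show ?thesis
      using u[OF that] by (simp add: scal_image_mult scal_image_one unit_at_def)
  qed
  moreover have "unit_at P (inverse (u P))" if "P \<in> supp F" for P
    using u that unit_at_inverse by blast
  moreover have "c = d * (\<Prod>P\<in>supp F. residue_norm \<iota> P (inverse (u P)) powi F P)"
  proof -
    have "(\<Prod>P\<in>supp F. residue_norm \<iota> P (inverse (u P)) powi F P)
      = inverse (\<Prod>P\<in>supp F. residue_norm \<iota> P (u P) powi F P)"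
      unfolding prod_inversef[symmetric] using u
      by (intro prod.cong) (simp_all add: residue_norm_inverse(2)[OF P hom] power_int_inverse)
    moreover have "(\<Prod>P\<in>supp F. residue_norm \<iota> P (u P) powi F P) \<noteq> 0"
      using F u residue_norm_inverse(1)[OF P hom] by (simp add: divisors_def)
    ultimately show ?thesis by (simp add: d)
  qed
  moreover have "(c, \<phi>) \<in> norm_reps M F"
    using x unfolding xy .
  ultimately show ?thesis
    unfolding xy by (intro norm_classI)
qed

lemma norm_class_trans:
  assumes F: "F \<in> divisors \<iota>"
    and y: "y \<in> norm_class \<iota> M F x" and z: "z \<in> norm_class \<iota> M F y"
  shows "z \<in> norm_class \<iota> M F x"
proof -
  obtain c \<phi> d \<psi> e \<chi> where xyz: "x = (c, \<phi>)" "y = (d, \<psi>)" "z = (e, \<chi>)"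
    by (cases x, cases y, cases z)
  obtain u where u: "\<And>P. P \<in> supp F \<Longrightarrow> unit_at P (u P) \<and> \<phi> P = scal M (u P) ` \<psi> P"
    and d: "d = c * (\<Prod>P\<in>supp F. residue_norm \<iota> P (u P) powi F P)"
    using y by (auto simp: xyz norm_class_def)
  obtain v where v: "\<And>P. P \<in> supp F \<Longrightarrow> unit_at P (v P) \<and> \<psi> P = scal M (v P) ` \<chi> P"
    and e: "e = d * (\<Prod>P\<in>supp F. residue_norm \<iota> P (v P) powi F P)"
    using z by (auto simp: xyz norm_class_def)
  have P: "P \<in> closed_points \<iota>" if "P \<in> supp F" for P
    using F that by (auto simp: divisors_def)
  have "\<phi> P = scal M (u P * v P) ` \<chi> P" if "P \<in> supp F" for P
  proof -
    have "\<chi> P \<subseteq> mero M"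
      using norm_reps_subset_mero norm_class_subset_reps z that unfolding xyz by blast
    then show ?thesis using u[OF that] v[OF that] by (simp add: scal_image_mult)
  qed
  moreover have "unit_at P (u P * v P)" if "P \<in> supp F" for P
    using unit_at_mult[OF P[OF that]] u[OF that] v[OF that] by blast
  moreover have "e = c * (\<Prod>P\<in>supp F. residue_norm \<iota> P (u P * v P) powi F P)"
  proof -
    have "(\<Prod>P\<in>supp F. residue_norm \<iota> P (u P * v P) powi F P) =
        (\<Prod>P\<in>supp F. residue_norm \<iota> P (u P) powi F P * residue_norm \<iota> P (v P) powi F P)"
    proof (rule prod.cong[OF HOL.refl])
      fix P assume "P \<in> supp F"
      then have "residue_norm \<iota> P (u P * v P) = residue_norm \<iota> P (u P) * residue_norm \<iota> P (v P)"
        using u v by (intro residue_norm_mult[OF P hom]) (auto simp: unit_at_def)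
      then show "residue_norm \<iota> P (u P * v P) powi F P =
          residue_norm \<iota> P (u P) powi F P * residue_norm \<iota> P (v P) powi F P"
        by (simp add: power_int_mult_distrib)
    qed
    then show ?thesis by (simp add: d e prod.distrib mult.assoc)
  qed
  moreover have "(e, \<chi>) \<in> norm_reps M F"
    using z norm_class_subset_reps unfolding xyz by blast
  ultimately show ?thesis
    unfolding xyz by (intro norm_classI)
qed

lemma norm_class_eq:
  assumes F: "F \<in> divisors \<iota>" and x: "x \<in> norm_reps M F" and y: "y \<in> norm_class \<iota> M F x"
  shows "norm_class \<iota> M F y = norm_class \<iota> M F x"
  using norm_class_trans[OF F] norm_class_sym[OF F x y] y by blast

lemma norm_class_mult_mem:
  assumes F: "F \<in> divisors \<iota>" and G: "G \<in> divisors \<iota>"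
    and x: "(b, \<psi>) \<in> norm_class \<iota> M F (c, \<phi>)" and y: "(b', \<psi>) \<in> norm_class \<iota> M G (c', \<phi>)"
  shows "(b * b', \<psi>) \<in> norm_class \<iota> M (F + G) (c * c', \<phi>)"
proof -
  obtain u where u: "\<And>P. P \<in> supp F \<Longrightarrow> unit_at P (u P) \<and> \<phi> P = scal M (u P) ` \<psi> P"
    and b: "b = c * (\<Prod>P\<in>supp F. residue_norm \<iota> P (u P) powi F P)"
    using x by (auto simp: norm_class_def)
  obtain v where v: "\<And>P. P \<in> supp G \<Longrightarrow> unit_at P (v P) \<and> \<phi> P = scal M (v P) ` \<psi> P"
    and b': "b' = c' * (\<Prod>P\<in>supp G. residue_norm \<iota> P (v P) powi G P)"
    using y by (auto simp: norm_class_def)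
  \<comment> \<open>On the common support \<open>u\<close> and \<open>v\<close> agree only modulo the maximal ideal, which suffices for
    the norms.\<close>
  define w where "w P = (if P \<in> supp F then u P else v P)" for P
  have P: "P \<in> closed_points \<iota>" if "P \<in> supp F \<union> supp G" for P
    using F G that by (auto simp: divisors_def)
  have w: "unit_at P (w P) \<and> \<phi> P = scal M (w P) ` \<psi> P" if "P \<in> supp F \<union> supp G" for P
    using that u v by (auto simp: w_def)
  have "residue_norm \<iota> P (v P) = residue_norm \<iota> P (w P)" if PG: "P \<in> supp G" for P
  proof -
    obtain m where "generates_at M P m" "\<psi> P = fibre_elt M P m"
      using norm_reps_fibre[OF subsetD[OF norm_class_subset_reps y] PG] by blast
    then show ?thesis
      using scal_image_fibre_cong[OF P, of P m "v P" "w P"] v[of P] w[of P] PG by auto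
  qed
  then have "b' = c' * (\<Prod>P\<in>supp G. residue_norm \<iota> P (w P) powi G P)"
    by (simp add: b')
  moreover have "b = c * (\<Prod>P\<in>supp F. residue_norm \<iota> P (w P) powi F P)"
    by (simp add: b w_def)
  moreover have "(\<Prod>P\<in>supp (F + G). residue_norm \<iota> P (w P) powi (F + G) P)
    = (\<Prod>P\<in>supp F. residue_norm \<iota> P (w P) powi F P)
      * (\<Prod>P\<in>supp G. residue_norm \<iota> P (w P) powi G P)"
    using F G w residue_norm_inverse(1)[OF P hom]
    by (intro prod_powi_add) (auto simp: divisors_def)
  ultimately have "b * b' = c * c' * (\<Prod>P\<in>supp (F + G). residue_norm \<iota> P (w P) powi (F + G) P)"
    by (simp add: mult_ac)
  moreover have "(b * b', \<psi>) \<in> norm_reps M (F + G)"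
    using norm_class_subset_reps x y by (blast intro: norm_reps_add)
  moreover have "unit_at P (w P)" "\<phi> P = scal M (w P) ` \<psi> P" if "P \<in> supp (F + G)" for P
    using w subsetD[OF supp_add_subset that] by simp_all
  ultimately show ?thesis by (intro norm_classI)
qed

text \<open>\<open>norm_mult\<close> is a union over all pairs of representatives with a common
  second component. Each such pair yields the same product class, and the given pair is one of them,
  so the union is that class.\<close>

lemma norm_mult_norm_class:
  assumes F: "F \<in> divisors \<iota>" and G: "G \<in> divisors \<iota>"
    and x: "(c, \<phi>) \<in> norm_reps M F" and y: "(c', \<phi>) \<in> norm_reps M G"
  shows "norm_mult \<iota> M F G (norm_class \<iota> M F (c, \<phi>)) (norm_class \<iota> M G (c', \<phi>))
    = norm_class \<iota> M (F + G) (c * c', \<phi>)"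
proof -
  have xy: "(c * c', \<phi>) \<in> norm_reps M (F + G)"
    using x y by (rule norm_reps_add)
  have "norm_class \<iota> M (F + G) (b * b', \<psi>) = norm_class \<iota> M (F + G) (c * c', \<phi>)"
    if "(b, \<psi>) \<in> norm_class \<iota> M F (c, \<phi>)" "(b', \<psi>) \<in> norm_class \<iota> M G (c', \<phi>)" for b b' \<psi>
    by (rule norm_class_eq[OF divisors_add[OF F G] xy norm_class_mult_mem[OF F G that]])
  then have "{norm_class \<iota> M (F + G) (b * b', \<psi>) | b b' \<psi>.
      (b, \<psi>) \<in> norm_class \<iota> M F (c, \<phi>) \<and> (b', \<psi>) \<in> norm_class \<iota> M G (c', \<phi>)}
    = {norm_class \<iota> M (F + G) (c * c', \<phi>)}"
    using norm_class_self[OF F x] norm_class_self[OF G y] by blast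
  then show ?thesis by (simp add: norm_mult_def)
qed

end

section \<open>Scaling of norm elements and the norm of the section \<open>1\<close>\<close>

lemma norm_scale_norm_class:
  assumes "a \<noteq> 0"
  shows "norm_scale a (norm_class \<iota> M F (c, \<phi>)) = norm_class \<iota> M F (a * c, \<phi>)"
proof (intro equalityI subsetI)
  fix x assume "x \<in> norm_scale a (norm_class \<iota> M F (c, \<phi>))"
  then show "x \<in> norm_class \<iota> M F (a * c, \<phi>)"
    by (auto simp: norm_scale_def norm_class_def norm_reps_def mult.assoc)
next
  fix x assume x: "x \<in> norm_class \<iota> M F (a * c, \<phi>)"
  obtain d \<psi> where d: "x = (d, \<psi>)" by (cases x)
  obtain u where "\<forall>P\<in>supp F. unit_at P (u P) \<and> \<phi> P = scal M (u P) ` \<psi> P"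
    "d = a * c * (\<Prod>P\<in>supp F. residue_norm \<iota> P (u P) powi F P)"
    using x by (auto simp: d norm_class_def)
  then have "(d / a, \<psi>) \<in> norm_class \<iota> M F (c, \<phi>)"
    using x assms by (auto simp: d norm_class_def norm_reps_def)
  then have "(a * (d / a), \<psi>) \<in> norm_scale a (norm_class \<iota> M F (c, \<phi>))"
    unfolding norm_scale_def by force
  then show "x \<in> norm_scale a (norm_class \<iota> M F (c, \<phi>))" using assms by (simp add: d)
qed

lemma norm_scale_norm_scale: "norm_scale a (norm_scale b \<nu>) = norm_scale (a * b) \<nu>"
  by (force simp: norm_scale_def image_image mult.assoc)

lemma norm_scale_one: "norm_scale 1 \<nu> = \<nu>"
  by (simp add: norm_scale_def)

lemma norm_scale_norm_map: "norm_scale a (norm_map g \<nu>) = norm_map g (norm_scale a \<nu>)"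
  by (force simp: norm_scale_def norm_map_def image_image)

lemma norm_scale_mem_norm_torsor:
  assumes a: "a \<noteq> 0" and \<nu>: "\<nu> \<in> norm_torsor \<iota> M F"
  shows "norm_scale a \<nu> \<in> norm_torsor \<iota> M F"
proof -
  obtain c \<phi> where "(c, \<phi>) \<in> norm_reps M F" "c \<noteq> 0" "\<nu> = norm_class \<iota> M F (c, \<phi>)"
    using \<nu> by (auto simp: norm_torsor_def)
  then have "(a * c, \<phi>) \<in> norm_reps M F" "a * c \<noteq> 0"
    "norm_scale a \<nu> = norm_class \<iota> M F (a * c, \<phi>)"
    using a by (auto simp: norm_reps_def norm_scale_norm_class)
  then show ?thesis unfolding norm_torsor_def by blast
qed

text \<open>The zero divisor has empty support, so the cosets impose no condition. This is where
  norms of sections meet the canonical trivialisation.\<close>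

lemma norm_section_zero: "norm_section \<iota> M 0 s = norm_const \<iota> M 1"
  by (auto simp: norm_section_def norm_const_def norm_class_def supp_zero)

text \<open>At a point of the support of \<open>F\<close> the divisor \<open>E\<close> has
  coefficient 0, so the stalk of its bundle there is the local ring, generated by
  \<open>1\<close>.\<close>

lemma one_mem_norm_reps:
  assumes "F \<in> divisors \<iota>" "disjoint_divisors F E"
  shows "(c, \<lambda>P. fibre_elt (divisor_bundle E) P 1) \<in> norm_reps (divisor_bundle E) F"
proof -
  have "generates_at (divisor_bundle E) P 1" if "P \<in> supp F" for P
  proof (rule generates_at_divisor_bundle_one)
    show "P \<in> closed_points \<iota>" using assms(1) that by (auto simp: divisors_def)
    show "E P = 0" using assms(2) that by (auto simp: disjoint_divisors_def supp_def)
  qed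
  then show ?thesis by (auto simp: norm_reps_def)
qed

lemma norm_section_one_mem_norm_torsor:
  assumes "F \<in> divisors \<iota>" "disjoint_divisors F E"
  shows "norm_section \<iota> (divisor_bundle E) F 1 \<in> norm_torsor \<iota> (divisor_bundle E) F"
  using one_mem_norm_reps[OF assms] by (auto simp: norm_section_def norm_torsor_def intro!: imageI)

text \<open>Both norms are represented by the family of cosets of the section \<open>1\<close>, so
  only the scalars \<open>1\<close> and \<open>a\<close> are multiplied.\<close>

lemma norm_mult_section_one:
  assumes hom: "field_hom \<iota>" and E: "E \<in> divisors \<iota>"
    and F: "F \<in> divisors \<iota>" "disjoint_divisors F E"
    and G: "G \<in> divisors \<iota>" "disjoint_divisors G E" and a: "a \<noteq> 0"
  shows "norm_mult \<iota> (divisor_bundle E) F G (norm_section \<iota> (divisor_bundle E) F 1)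
      (norm_scale a (norm_section \<iota> (divisor_bundle E) G 1))
    = norm_scale a (norm_section \<iota> (divisor_bundle E) (F + G) 1)"
  using norm_mult_norm_class[OF hom line_bundle_divisor_bundle[OF E] F(1) G(1)
      one_mem_norm_reps[OF F] one_mem_norm_reps[OF G], of 1 a] a
  by (simp add: norm_section_def norm_scale_norm_class)

section \<open>The Poincare torsor\<close>

lemma poincare_class_eqI:
  "equivclp (poincare_step \<iota>) t t' \<Longrightarrow> poincare_class \<iota> t = poincare_class \<iota> t'"
  unfolding poincare_class_def by (blast intro: equivclp_trans equivclp_sym)

text \<open>\<open>norm_map\<close> leaves scalars alone, and the free scalar in
  \<open>change_D\<close> absorbs \<open>a\<close>.\<close>

lemma poincare_step_scale:
  assumes a: "a \<noteq> 0" and step: "poincare_step \<iota> (D, E, \<nu>) (D', E', \<nu>')"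
  shows "poincare_step \<iota> (D, E, norm_scale a \<nu>) (D', E', norm_scale a \<nu>')"
  using step
proof cases
  case (change_E f)
  then show ?thesis
    using a poincare_step.change_E[of f E' \<iota> D "norm_scale a \<nu>"] norm_scale_mem_norm_torsor[OF a]
    by (auto simp: norm_scale_norm_map poincare_reps_def)
next
  case (change_D f s b)
  then show ?thesis
    using a poincare_step.change_D[of f s "a * b" D' \<iota> E]
    by (simp add: norm_scale_norm_scale mult.assoc)
qed

lemma equivclp_poincare_scale:
  assumes a: "a \<noteq> 0" and eq: "equivclp (poincare_step \<iota>) t t'"
  shows "equivclp (poincare_step \<iota>) ((\<lambda>(D, E, \<nu>). (D, E, norm_scale a \<nu>)) t)
    ((\<lambda>(D, E, \<nu>). (D, E, norm_scale a \<nu>)) t')"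
  using eq
proof (induction rule: equivclp_induct)
  case base
  then show ?case by simp
next
  case (step t' t'')
  have "equivclp (poincare_step \<iota>) ((\<lambda>(D, E, \<nu>). (D, E, norm_scale a \<nu>)) t')
    ((\<lambda>(D, E, \<nu>). (D, E, norm_scale a \<nu>)) t'')"
    using step(2)
  proof
    assume "poincare_step \<iota> t' t''"
    then show ?thesis
      by (cases t', cases t'') (auto dest: poincare_step_scale[OF a])
  next
    assume "poincare_step \<iota> t'' t'"
    then show ?thesis
      by (cases t', cases t'') (auto dest: poincare_step_scale[OF a] intro: equivclp_sym)
  qed
  with step.IH show ?case by (rule equivclp_trans)
qed

text \<open>Scaling a class means taking its pointwise image. That the image is again a full class
  is seen by scaling a chain of identifications back with \<open>inverse a\<close>.\<close>

lemma poincare_scale_poincare_class: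
  assumes a: "a \<noteq> 0"
  shows "poincare_scale a (poincare_class \<iota> (D, E, \<nu>)) = poincare_class \<iota> (D, E, norm_scale a \<nu>)"
proof (intro equalityI subsetI)
  fix t assume "t \<in> poincare_scale a (poincare_class \<iota> (D, E, \<nu>))"
  then show "t \<in> poincare_class \<iota> (D, E, norm_scale a \<nu>)"
    using equivclp_poincare_scale[OF a, of \<iota> "(D, E, \<nu>)"]
    by (fastforce simp: poincare_scale_def poincare_class_def)
next
  fix t assume t: "t \<in> poincare_class \<iota> (D, E, norm_scale a \<nu>)"
  obtain D' E' \<nu>' where t': "t = (D', E', \<nu>')" by (cases t)
  have "equivclp (poincare_step \<iota>) (D, E, \<nu>) (D', E', norm_scale (inverse a) \<nu>')"
    using equivclp_poincare_scale[of "inverse a" \<iota> "(D, E, norm_scale a \<nu>)" t] t a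
    by (simp add: t' poincare_class_def norm_scale_norm_scale norm_scale_one)
  moreover have "t = (\<lambda>(D, E, \<nu>). (D, E, norm_scale a \<nu>)) (D', E', norm_scale (inverse a) \<nu>')"
    using a by (simp add: t' norm_scale_norm_scale norm_scale_one)
  ultimately show "t \<in> poincare_scale a (poincare_class \<iota> (D, E, \<nu>))"
    unfolding poincare_scale_def poincare_class_def by blast
qed

lemma poincare_class_principal:
  assumes h: "h \<noteq> 0" and div: "principal_divisor \<iota> h \<in> divisors0 \<iota>" and E: "E \<in> divisors0 \<iota>"
    and disj: "disjoint_divisors E (principal_divisor \<iota> h)"
    and a: "a \<noteq> 0" and unity: "a * value_at \<iota> h E = 1"
  shows "poincare_class \<iota> (principal_divisor \<iota> h, E,
      norm_scale a (norm_section \<iota> (divisor_bundle E) (principal_divisor \<iota> h) 1))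
    = poincare_class \<iota> (0, E, norm_const \<iota> (divisor_bundle E) 1)"
proof -
  have "bundle_div \<iota> (divisor_bundle E) 1 = E"
    using E by (simp add: bundle_div_divisor_bundle_one divisors0_def)
  \<comment> \<open>The identification is used with the zero divisor and the section
    \<open>1\<close>, whose divisor is \<open>E\<close>. It multiplies \<open>a\<close> by the value
    of \<open>h\<close> at \<open>E\<close>, which gives 1 by \<open>unity\<close>.\<close>
  then have "poincare_step \<iota>
      (principal_divisor \<iota> h, E,
        norm_scale a (norm_section \<iota> (divisor_bundle E) (principal_divisor \<iota> h) 1))
      (0, E, norm_const \<iota> (divisor_bundle E) 1)"
    using poincare_step.change_D[of h 1 a 0 \<iota> E] h a div E disj unity
    by (simp add: divisors0_zero disjoint_divisors_def supp_zero norm_scale_one norm_section_zero)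
  then show ?thesis by (intro poincare_class_eqI r_into_equivclp)
qed

theorem mainTheorem7:
  fixes \<iota> :: "'k::field \<Rightarrow> 'f::field"
    and L :: "('f, 'm::ab_group_add) lbundle"
    and L2 :: "('f, 'n::ab_group_add) lbundle" and mul :: "'m \<Rightarrow> 'm \<Rightarrow> 'n"
    and \<delta> :: int
    and d0 e0 :: 'm and s :: 'n
    and D E D' D0 E0 :: "'f divisor"
  assumes "curve \<iota>"
    and "\<exists>P\<in>closed_points \<iota>. residue_degree \<iota> P = 1"
    and "line_bundle \<iota> L" and "has_degree \<iota> L \<delta>" and "\<delta> \<ge> 2 * int (genus \<iota>) + 1"
    and "tensor_product \<iota> L L L2 mul"
    and "d0 \<in> global_sections \<iota> L" and "d0 \<noteq> 0" and "D0 = bundle_div \<iota> L d0"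
    and "e0 \<in> global_sections \<iota> L" and "e0 \<noteq> 0" and "E0 = bundle_div \<iota> L e0"
    and "disjoint_divisors D0 E0"
    and "D \<in> effective_divisors \<iota>" and "div_degree \<iota> D = \<delta>"
    and "E \<in> effective_divisors \<iota>" and "div_degree \<iota> E = \<delta>"
    and "disjoint_divisors D0 E" and "disjoint_divisors D E0" and "disjoint_divisors D E"
    and "s \<in> global_sections \<iota> L2" and "s \<noteq> 0"
    and "D' \<in> effective_divisors \<iota>" and "div_degree \<iota> D' = \<delta>"
    and "bundle_div \<iota> L2 s = D + D'"
    and "disjoint_divisors D' E" and "disjoint_divisors D' E0"
  shows
    "let x = bundle_class \<iota> (twist (dual_bundle L) D);
         x' = bundle_class \<iota> (twist (dual_bundle L) D');
         y = bundle_class \<iota> (twist (dual_bundle L) E);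
         lam = value_at \<iota> (section_ratio L2 s (mul d0 d0)) E0
               * value_at \<iota> (section_ratio L2 (mul d0 d0) s) E
     in x \<in> jacobian \<iota> \<and> x' \<in> jacobian \<iota> \<and> pic_add x x' = pic_class \<iota> 0 \<and> lam \<noteq> 0 \<and>
        left_inverse \<iota> x y (pair_point \<iota> (D - D0) (E - E0))
          (poincare_scale lam (pair_point \<iota> (D' - D0) (E - E0)))"
proof -
  have hom: "field_hom \<iota>"
    using assms(1) by (simp add: curve_def function_field_def)
  have L: "line_bundle \<iota> L" by (rule assms(3))
  have L2: "line_bundle \<iota> L2" using assms(6) by (simp add: tensor_product_def)
  \<comment> \<open>The rational point supplies a place at which \<open>mul d0 d0\<close> is seen
    not to vanish.\<close>
  obtain P0 where P0: "P0 \<in> closed_points \<iota>" using assms(2) by blast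
  have d0: "d0 \<in> mero L" "d0 \<noteq> 0" and e0: "e0 \<in> mero L" "e0 \<noteq> 0"
    and s: "s \<in> mero L2" "s \<noteq> 0"
    using assms(7,8,10,11,21,22) by (auto simp: global_sections_def)
  have D0: "D0 \<in> divisors \<iota>" "div_degree \<iota> D0 = \<delta>"
    and E0: "E0 \<in> divisors \<iota>" "div_degree \<iota> E0 = \<delta>"
    using assms(4) d0 e0 by (auto simp: has_degree_def assms(9,12))
  have D: "D \<in> divisors \<iota>" and D': "D' \<in> divisors \<iota>" and E: "E \<in> divisors \<iota>"
    using assms(14,16,23) by (auto simp: effective_divisors_def)
  \<comment> \<open>A common second divisor for both points, so that their product can be formed on
    representatives.\<close>
  define A where "A = E - E0"
  have A: "A \<in> divisors0 \<iota>" and X: "D - D0 \<in> divisors0 \<iota>" and X': "D' - D0 \<in> divisors0 \<iota>"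
    unfolding A_def using D0 E0 D D' E assms(15,17,24) by (auto intro!: divisors0_diffI)
  then have A_div: "A \<in> divisors \<iota>" and X_div: "D - D0 \<in> divisors \<iota>"
    and X'_div: "D' - D0 \<in> divisors \<iota>"
    by (simp_all add: divisors0_def)
  have principal: "principal_divisor \<iota> f \<in> divisors0 \<iota>" if "f \<noteq> 0" for f
    by (rule principal_divisor_mem_divisors0[OF L assms(4) that])
  then have principal_div: "principal_divisor \<iota> f \<in> divisors \<iota>" if "f \<noteq> 0" for f
    using that by (simp add: divisors0_def)

  have dd: "mul d0 d0 \<in> mero L2" "mul d0 d0 \<noteq> 0"
    using tensor_product_nonzero(1)[OF assms(6) L L d0 d0 P0] assms(6) d0
    by (auto simp: tensor_product_def)
  obtain h where h: "s = scal L2 h (mul d0 d0)"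
    using line_bundle_span[OF L2 s(1) dd] by blast
  have h0: "h \<noteq> 0" using h s line_bundle_scal_zero(1)[OF L2 dd(1)] by auto
  have h': "mul d0 d0 = scal L2 (inverse h) s"
    using h h0 line_bundle_scal(2,3)[OF L2 dd(1)] by (metis Fields.left_inverse)
  have ratio: "section_ratio L2 s (mul d0 d0) = h"
    unfolding h by (rule section_ratio_scal[OF L2 dd])
  have ratio': "section_ratio L2 (mul d0 d0) s = inverse h"
    by (subst h') (rule section_ratio_scal[OF L2 s])
  have div_h: "principal_divisor \<iota> h = (D - D0) + (D' - D0)"
  proof -
    have "D + D' = D0 + D0 + principal_divisor \<iota> h"
      using bundle_div_scal[OF L2 dd h0] bundle_div_tensor_product[OF assms(6) L L d0 d0] assms(25)
      by (simp add: assms(9) flip: h)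
    then show ?thesis by (simp add: algebra_simps)
  qed

  \<comment> \<open>Disjointness is kept for \<open>E\<close> and \<open>E0\<close> separately:
    common points can cancel in \<open>A\<close>, while the constant evaluates \<open>h\<close> at
    both divisors.\<close>
  have disj: "disjoint_divisors (D - D0) E" "disjoint_divisors (D' - D0) E"
    "disjoint_divisors (D - D0) E0" "disjoint_divisors (D' - D0) E0"
    using assms(13,18,19,20,26,27) by (auto intro: disjoint_divisors_diff_left)
  have disj_A: "disjoint_divisors (D - D0) A" "disjoint_divisors (D' - D0) A"
    unfolding A_def by (intro disjoint_divisors_diff_right disj)+
  have unit: "unit_at P h" if "P \<in> supp E \<union> supp E0" for P
  proof -
    have P: "P \<in> closed_points \<iota>" using that E E0 by (auto simp: divisors_def)
    have "(D - D0) P = 0" "(D' - D0) P = 0"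
      using that disj by (auto simp: disjoint_divisors_def supp_def)
    then have "principal_divisor \<iota> h P = 0"
      unfolding div_h by simp
    then show ?thesis
      using unit_at_iff_ord[OF P h0] P by (simp add: principal_divisor_def)
  qed
  \<comment> \<open>The inverse of the value of \<open>h\<close> at \<open>A\<close>: as
    \<open>A\<close> is \<open>E - E0\<close>, the value at \<open>E0\<close> enters directly and
    the value at \<open>E\<close> inverted.\<close>
  define lam where "lam = value_at \<iota> h E0 * value_at \<iota> (inverse h) E"
  have vals: "value_at \<iota> h E0 \<noteq> 0" "value_at \<iota> h E \<noteq> 0"
    "value_at \<iota> (inverse h) E = inverse (value_at \<iota> h E)"
    using value_at_nonzero[OF hom] value_at_inverse[OF hom] E E0 unit by auto
  then have lam: "lam \<noteq> 0" by (simp add: lam_def)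
  have "value_at \<iota> h A = value_at \<iota> h E / value_at \<iota> h E0"
    unfolding A_def by (rule value_at_diff[OF hom E E0(1)]) (rule unit)
  then have lam_value: "lam * value_at \<iota> h A = 1"
    using vals by (simp add: lam_def)

  let ?x = "bundle_class \<iota> (twist (dual_bundle L) D)"
    and ?x' = "bundle_class \<iota> (twist (dual_bundle L) D')"
    and ?y = "bundle_class \<iota> (twist (dual_bundle L) E)"
  have x: "?x = {D - D0 + principal_divisor \<iota> f | f. f \<noteq> 0}"
    and x': "?x' = {D' - D0 + principal_divisor \<iota> f | f. f \<noteq> 0}"
    unfolding assms(9) by (rule bundle_class_twist_dual[OF L d0] D D')+
  \<comment> \<open>The class of \<open>E\<close> is computed from \<open>e0\<close> rather than
    \<open>d0\<close>, which exhibits \<open>A\<close> as one of its divisors.\<close>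
  have y: "?y = {A + principal_divisor \<iota> f | f. f \<noteq> 0}"
    unfolding A_def assms(12) by (rule bundle_class_twist_dual[OF L e0 E])
  have self: "F \<in> {F + principal_divisor \<iota> f | f. f \<noteq> 0}" for F
    using principal_divisor_one[of \<iota>] by (metis (mono_tags, lifting) add_0_right mem_Collect_eq one_neq_zero)
  have "?x = pic_class \<iota> (D - D0)" "?x' = pic_class \<iota> (D' - D0)"
    unfolding x x' using pic_class_eq X_div X'_div principal_div by blast+
  then have jac: "?x \<in> jacobian \<iota>" "?x' \<in> jacobian \<iota>"
    using X X' by (auto simp: jacobian_def)

  have pic: "pic_add ?x ?x' = pic_class \<iota> 0"
  proof -
    have "pic_class \<iota> 0 = {0 + principal_divisor \<iota> f | f. f \<noteq> 0}"
      using divisors0_zero principal_div by (intro pic_class_eq) (auto simp: divisors0_def)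
    moreover have "pic_add ?x ?x' \<subseteq> {0 + principal_divisor \<iota> f | f. f \<noteq> 0}"
    proof
      fix F assume "F \<in> pic_add ?x ?x'"
      then obtain f g where fg: "f \<noteq> 0" "g \<noteq> 0"
        and F: "F = (D - D0 + principal_divisor \<iota> f) + (D' - D0 + principal_divisor \<iota> g)"
        unfolding pic_add_def x x' by blast
      \<comment> \<open>The two base divisors add up to the divisor of \<open>h\<close>, which
        accounts for the extra factor.\<close>
      then have "F = 0 + principal_divisor \<iota> (h * f * g)"
        using h0 by (simp add: principal_divisor_mult div_h algebra_simps)
      then show "F \<in> {0 + principal_divisor \<iota> f | f. f \<noteq> 0}"
        using fg h0 by (metis (mono_tags, lifting) mem_Collect_eq mult_eq_0_iff)
    qed
    moreover have "{0 + principal_divisor \<iota> f | f. f \<noteq> 0} \<subseteq> pic_add ?x ?x'"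
    proof
      fix F assume "F \<in> {0 + principal_divisor \<iota> f | f. f \<noteq> 0}"
      then obtain f where f: "f \<noteq> 0" "F = principal_divisor \<iota> f" by auto
      \<comment> \<open>The whole translation goes into the second summand; \<open>inverse h\<close>
        cancels the divisor of \<open>h\<close> contributed by the two base divisors.\<close>
      have "principal_divisor \<iota> (h * (inverse h * f))
        = principal_divisor \<iota> h + principal_divisor \<iota> (inverse h * f)"
        using f h0 by (intro principal_divisor_mult) auto
      then have "F = (D - D0) + (D' - D0 + principal_divisor \<iota> (inverse h * f))"
        using f h0 by (simp add: div_h algebra_simps)
      moreover have "D - D0 \<in> ?x" unfolding x by (rule self)
      moreover have "D' - D0 + principal_divisor \<iota> (inverse h * f) \<in> ?x'"
        unfolding x' using f h0 by (auto intro!: exI[of _ "inverse h * f"])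
      ultimately show "F \<in> pic_add ?x ?x'" unfolding pic_add_def by blast
    qed
    ultimately show ?thesis by blast
  qed

  let ?B = "divisor_bundle A"
  let ?\<nu> = "norm_section \<iota> ?B (D - D0) 1 :: ('k, 'f, 'f) norm_elt"
    and ?\<nu>' = "norm_scale lam (norm_section \<iota> ?B (D' - D0) 1) :: ('k, 'f, 'f) norm_elt"
  have reps: "(D - D0, A, ?\<nu>) \<in> poincare_reps \<iota>" "(D' - D0, A, ?\<nu>') \<in> poincare_reps \<iota>"
    using X X' A norm_section_one_mem_norm_torsor[OF X_div disj_A(1)]
      norm_scale_mem_norm_torsor[OF lam norm_section_one_mem_norm_torsor[OF X'_div disj_A(2)]]
    by (simp_all add: poincare_reps_def)
  have rho: "poincare_scale lam (pair_point \<iota> (D' - D0) A) = poincare_class \<iota> (D' - D0, A, ?\<nu>')"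
    by (simp add: pair_point_def poincare_scale_poincare_class[OF lam])
  have A_y: "A \<in> ?y" unfolding y by (rule self)
  have pi_fibre: "pair_point \<iota> (D - D0) A \<in> poincare_fibre \<iota> ?x ?y"
    using reps(1) A_y self[of "D - D0"] x unfolding pair_point_def poincare_fibre_def by blast
  have "D' - D0 \<in> pic_neg ?x"
  proof -
    \<comment> \<open>As \<open>(D - D0) + (D' - D0)\<close> is the divisor of \<open>h\<close>, the
      negative of \<open>D' - D0\<close> is \<open>D - D0\<close> translated by the divisor of
      \<open>inverse h\<close>.\<close>
    have "D' - D0 = - (D - D0 + principal_divisor \<iota> (inverse h))"
      using h0 by (simp add: principal_divisor_inverse div_h)
    moreover have "D - D0 + principal_divisor \<iota> (inverse h) \<in> ?x"
      unfolding x using h0 by (auto intro!: exI[of _ "inverse h"])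
    ultimately show ?thesis unfolding pic_neg_def by blast
  qed
  then have rho_fibre: "poincare_class \<iota> (D' - D0, A, ?\<nu>') \<in> poincare_fibre \<iota> (pic_neg ?x) ?y"
    using reps(2) A_y unfolding poincare_fibre_def by blast
  have "disjoint_divisors A (principal_divisor \<iota> h)"
    unfolding div_h using disj_A by (blast intro: disjoint_divisors_add_right disjoint_divisors_sym)
  then have "poincare_class \<iota> (principal_divisor \<iota> h, A,
      norm_scale lam (norm_section \<iota> ?B (principal_divisor \<iota> h) 1))
    = poincare_class \<iota> (0, A, norm_const \<iota> ?B 1)"
    by (rule poincare_class_principal[OF h0 principal[OF h0] A _ lam lam_value])
  \<comment> \<open>By \<open>div_h\<close> the product lives over the divisor of \<open>h\<close>,
    and the product of the two norms is \<open>lam\<close> times the norm of \<open>1\<close> along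
    it.\<close>
  then have prod: "poincare_class \<iota> ((D - D0) + (D' - D0), A, norm_mult \<iota> ?B (D - D0) (D' - D0) ?\<nu> ?\<nu>')
    = poincare_class \<iota> (0, A, norm_const \<iota> ?B 1)"
    using norm_mult_section_one[OF hom A_div X_div disj_A(1) X'_div disj_A(2) lam]
    by (simp only: div_h)
  have "left_inverse \<iota> ?x ?y (pair_point \<iota> (D - D0) A) (poincare_class \<iota> (D' - D0, A, ?\<nu>'))"
    unfolding left_inverse_def
  proof (intro conjI exI)
    \<comment> \<open>This goal fixes the existential witness: the class of the scalar 1 over
      \<open>(0, A)\<close>, with the same \<open>A\<close> on which the product is formed.\<close>
    show "left_product \<iota> (pair_point \<iota> (D - D0) A) (poincare_class \<iota> (D' - D0, A, ?\<nu>'))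
        (poincare_class \<iota> (0, A, norm_const \<iota> ?B 1))"
      unfolding left_product_def pair_point_def using reps prod by metis
    show "trivialised \<iota> ?y (poincare_class \<iota> (0, A, norm_const \<iota> ?B 1)) 1"
      unfolding trivialised_def using A_y by blast
  qed (rule pi_fibre rho_fibre)+
  then show ?thesis
    using jac pic lam unfolding Let_def ratio ratio' lam_def[symmetric] A_def[symmetric] rho
    by blast
qed

end
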